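(* Let $\mathcal{T}$ and $\mathcal{T}'$ be bi-complete triangulated categories, and let $F\colon\mathcal{T}\rightarrow\mathcal{T}'$ be a bi-continuous triangle functor. Assume that the following conditions are fulfilled. (1) There is a pre-weight structure $(\mathcal{U}_{\geq0},\mathcal{U}_{\leq0})$ on $\mathcal{T}$ with finite dimension. (2) We have $\mathcal{U}_{\leq0}\subseteq\mathrm{Loc}\langle\mathcal{U}_b\rangle$ and $\mathcal{U}_{\geq0}\subseteq\mathrm{coLoc}\langle\mathcal{U}_b\rangle$. (3) The functor $F$ is bounded with respect to $(\mathcal{U}_{\geq0},\mathcal{U}_{\leq0})$. (4) The restriction $F|_{\mathcal{U}_b}\colon\mathcal{U}_b\rightarrow\mathcal{T}'$ is fully faithful. Then the functor $F$ is fully faithful.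
   Context: Let $\Sigma$ be the suspension functor. For full subcategories $\mathcal{X},\mathcal{Y}$ of $\mathcal{T}$, $\mathcal{X}\ast\mathcal{Y}$ is the full subcategory of objects $Z$ fitting into an exact triangle $X\to Z\to Y\to\Sigma(X)$ with $X\in\mathcal{X}$, $Y\in\mathcal{Y}$; $\mathcal{X}$ is closed under extensions if $\mathcal{X}\ast\mathcal{X}\subseteq\mathcal{X}$. A pre-weight structure on $\mathcal{T}$ is a pair $(\mathcal{U}_{\geq0},\mathcal{U}_{\leq0})$ of full additive subcategories such that (i) $\mathcal{U}_{\geq0}\ast\Sigma(\mathcal{U}_{\leq0})=\mathcal{T}$; (ii) $\mathcal{U}_{\geq0}$ is closed under $\Sigma^{-1}$ and extensions; (iii) $\mathcal{U}_{\leq0}$ is closed under $\Sigma$ and extensions. Put $\mathcal{U}_{\geq m}=\Sigma^{-m}(\mathcal{U}_{\geq0})$, $\mathcal{U}_{\leq m}=\Sigma^{-m}(\mathcal{U}_{\leq0})$, $\mathcal{U}_{[m,n]}=\mathcal{U}_{\geq m}\cap\mathcal{U}_{\leq n}$ for $m\le n$, and $\mathcal{U}_b=\bigcup_{m\leq n}\mathcal{U}_{[m,n]}$, a triangulated subcategory of $\mathcal{T}$. The dimension of the pre-weight structure is $\min\{+\infty,\ d\geq-1\mid\mathrm{Hom}_{\mathcal{T}}(\mathcal{U}_{\geq0},\mathcal{U}_{\leq-(d+1)})=0\}$; it is finite if this is not $+\infty$. $\mathcal{T}$ is bi-complete if it has arbitrary coproducts and products; a triangle functor is bi-continuous if it preserves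 arbitrary coproducts and products. $\mathrm{Loc}\langle\mathcal{S}\rangle$ (resp. $\mathrm{coLoc}\langle\mathcal{S}\rangle$) is the smallest triangulated subcategory of $\mathcal{T}$ containing $\mathcal{S}$ and closed under arbitrary coproducts (resp. products). A triangle functor $F\colon\mathcal{T}\to\mathcal{T}'$ is bounded with respect to $(\mathcal{U}_{\geq0},\mathcal{U}_{\leq0})$ if there is a natural number $n_0$ with $\mathrm{Hom}_{\mathcal{T}'}(F(\mathcal{U}_{\geq0}),F(\mathcal{U}_{\leq-n_0}))=0$. $\mathrm{Hom}(\mathcal{X},\mathcal{Y})=0$ means $\mathrm{Hom}(X,Y)=0$ for all $X\in\mathcal{X},Y\in\mathcal{Y}$. *)

theory Defs
  imports "HOL-Algebra.Group" "HOL-Library.Extended_Real"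
begin

section \<open>Categories and functors\<close>

record ('o, 'm) cat =
  Obj :: "'o set"
  Arr :: "'m set"
  Dom :: "'m \<Rightarrow> 'o"
  Cod :: "'m \<Rightarrow> 'o"
  Ident :: "'o \<Rightarrow> 'm"
  Comp :: "'m \<Rightarrow> 'm \<Rightarrow> 'm"  \<comment> \<open>\<open>Comp C g f\<close> is \<open>g\<close> after \<open>f\<close>\<close>

definition Hom :: "('o, 'm, 'a) cat_scheme \<Rightarrow> 'o \<Rightarrow> 'o \<Rightarrow> 'm set" where
  "Hom C X Y = {f \<in> Arr C. Dom C f = X \<and> Cod C f = Y}"

locale category =
  fixes C :: "('o, 'm, 'a) cat_scheme"
  assumes dom_obj: "f \<in> Arr C \<Longrightarrow> Dom C f \<in> Obj C"
    and cod_obj: "f \<in> Arr C \<Longrightarrow> Cod C f \<in> Obj C"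
    and ident_hom: "X \<in> Obj C \<Longrightarrow> Ident C X \<in> Hom C X X"
    and comp_hom: "f \<in> Hom C X Y \<Longrightarrow> g \<in> Hom C Y Z \<Longrightarrow> Comp C g f \<in> Hom C X Z"
    and comp_ident_right: "f \<in> Hom C X Y \<Longrightarrow> Comp C f (Ident C X) = f"
    and comp_ident_left: "f \<in> Hom C X Y \<Longrightarrow> Comp C (Ident C Y) f = f"
    and comp_assoc: "f \<in> Hom C W X \<Longrightarrow> g \<in> Hom C X Y \<Longrightarrow> h \<in> Hom C Y Z \<Longrightarrow>
      Comp C h (Comp C g f) = Comp C (Comp C h g) f"

definition is_iso :: "('o, 'm, 'a) cat_scheme \<Rightarrow> 'o \<Rightarrow> 'o \<Rightarrow> 'm \<Rightarrow> bool" where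
  "is_iso C X Y f \<longleftrightarrow> f \<in> Hom C X Y \<and>
     (\<exists>g \<in> Hom C Y X. Comp C g f = Ident C X \<and> Comp C f g = Ident C Y)"

definition isomorphic :: "('o, 'm, 'a) cat_scheme \<Rightarrow> 'o \<Rightarrow> 'o \<Rightarrow> bool" where
  "isomorphic C X Y \<longleftrightarrow> (\<exists>f. is_iso C X Y f)"

record ('o, 'm, 'p, 'n) functor_data =
  fobj :: "'o \<Rightarrow> 'p"
  farr :: "'m \<Rightarrow> 'n"

definition is_functor ::
  "('o, 'm, 'a) cat_scheme \<Rightarrow> ('p, 'n, 'b) cat_scheme \<Rightarrow> ('o, 'm, 'p, 'n) functor_data \<Rightarrow> bool"
  where
  "is_functor C D F \<longleftrightarrow>
     (\<forall>X \<in> Obj C. fobj F X \<in> Obj D) \<and>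
     (\<forall>X Y. \<forall>f \<in> Hom C X Y. farr F f \<in> Hom D (fobj F X) (fobj F Y)) \<and>
     (\<forall>X \<in> Obj C. farr F (Ident C X) = Ident D (fobj F X)) \<and>
     (\<forall>X Y Z. \<forall>f \<in> Hom C X Y. \<forall>g \<in> Hom C Y Z.
        farr F (Comp C g f) = Comp D (farr F g) (farr F f))"

definition id_functor :: "('o, 'm, 'o, 'm) functor_data" where
  "id_functor = \<lparr>fobj = (\<lambda>X. X), farr = (\<lambda>f. f)\<rparr>"

definition comp_functor ::
  "('p, 'n, 'q, 'k) functor_data \<Rightarrow> ('o, 'm, 'p, 'n) functor_data \<Rightarrow> ('o, 'm, 'q, 'k) functor_data"
  where
  "comp_functor G F = \<lparr>fobj = (\<lambda>X. fobj G (fobj F X)), farr = (\<lambda>f. farr G (farr F f))\<rparr>"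

definition natural_iso ::
  "('o, 'm, 'a) cat_scheme \<Rightarrow> ('p, 'n, 'b) cat_scheme \<Rightarrow> ('o, 'm, 'p, 'n) functor_data \<Rightarrow>
   ('o, 'm, 'p, 'n) functor_data \<Rightarrow> ('o \<Rightarrow> 'n) \<Rightarrow> bool" where
  "natural_iso C D F G \<eta> \<longleftrightarrow>
     (\<forall>X \<in> Obj C. is_iso D (fobj F X) (fobj G X) (\<eta> X)) \<and>
     (\<forall>X Y. \<forall>f \<in> Hom C X Y. Comp D (\<eta> Y) (farr F f) = Comp D (farr G f) (\<eta> X))"

definition is_equivalence ::
  "('o, 'm, 'a) cat_scheme \<Rightarrow> ('p, 'n, 'b) cat_scheme \<Rightarrow> ('o, 'm, 'p, 'n) functor_data \<Rightarrow> bool"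
  where
  "is_equivalence C D F \<longleftrightarrow> is_functor C D F \<and>
     (\<exists>G \<eta> \<epsilon>. is_functor D C G \<and>
        natural_iso C C id_functor (comp_functor G F) \<eta> \<and>
        natural_iso D D (comp_functor F G) id_functor \<epsilon>)"

text \<open>The restriction of a functor to the full subcategory on a class \<open>A\<close> of objects is fully
  faithful.\<close>

definition fully_faithful_on ::
  "('o, 'm, 'a) cat_scheme \<Rightarrow> ('p, 'n, 'b) cat_scheme \<Rightarrow> ('o, 'm, 'p, 'n) functor_data \<Rightarrow>
   'o set \<Rightarrow> bool" where
  "fully_faithful_on C D F A \<longleftrightarrow>
     (\<forall>X \<in> A. \<forall>Y \<in> A. bij_betw (farr F) (Hom C X Y) (Hom D (fobj F X) (fobj F Y)))"

definition fully_faithful ::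
  "('o, 'm, 'a) cat_scheme \<Rightarrow> ('p, 'n, 'b) cat_scheme \<Rightarrow> ('o, 'm, 'p, 'n) functor_data \<Rightarrow> bool"
  where
  "fully_faithful C D F \<longleftrightarrow> fully_faithful_on C D F (Obj C)"


section \<open>Arbitrary products and coproducts\<close>

definition is_coproduct ::
  "('o, 'm, 'a) cat_scheme \<Rightarrow> 'i set \<Rightarrow> ('i \<Rightarrow> 'o) \<Rightarrow> 'o \<Rightarrow> ('i \<Rightarrow> 'm) \<Rightarrow> bool" where
  "is_coproduct C I A P \<iota> \<longleftrightarrow> P \<in> Obj C \<and> (\<forall>i \<in> I. \<iota> i \<in> Hom C (A i) P) \<and>
     (\<forall>X \<in> Obj C. \<forall>f. (\<forall>i \<in> I. f i \<in> Hom C (A i) X) \<longrightarrow>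
        (\<exists>!h. h \<in> Hom C P X \<and> (\<forall>i \<in> I. Comp C h (\<iota> i) = f i)))"

definition is_product ::
  "('o, 'm, 'a) cat_scheme \<Rightarrow> 'i set \<Rightarrow> ('i \<Rightarrow> 'o) \<Rightarrow> 'o \<Rightarrow> ('i \<Rightarrow> 'm) \<Rightarrow> bool" where
  "is_product C I A P \<pi> \<longleftrightarrow> P \<in> Obj C \<and> (\<forall>i \<in> I. \<pi> i \<in> Hom C P (A i)) \<and>
     (\<forall>X \<in> Obj C. \<forall>f. (\<forall>i \<in> I. f i \<in> Hom C X (A i)) \<longrightarrow>
        (\<exists>!h. h \<in> Hom C X P \<and> (\<forall>i \<in> I. Comp C (\<pi> i) h = f i)))"

text \<open>
  ``Arbitrary'' (co)products are those indexed by small sets. A category with coproducts indexed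
  by its own set of arrows is a preorder, so smallness cannot be dropped, nor can the index type
  be tied to the types of objects and arrows. The predicate \<open>small\<close> on sets of indices plays the
  role of the set-theoretic universe; it is always a free parameter (with \<open>small = (\<lambda>_. True)\<close>
  every set over the index type is allowed).
\<close>

definition bi_complete :: "('i set \<Rightarrow> bool) \<Rightarrow> ('o, 'm, 'a) cat_scheme \<Rightarrow> bool" where
  "bi_complete small C \<longleftrightarrow>
     (\<forall>I A. small I \<and> (\<forall>i \<in> I. A i \<in> Obj C) \<longrightarrow>
        (\<exists>P \<iota>. is_coproduct C I A P \<iota>) \<and> (\<exists>P \<pi>. is_product C I A P \<pi>))"

definition bi_continuous ::
  "('i set \<Rightarrow> bool) \<Rightarrow> ('o, 'm, 'a) cat_scheme \<Rightarrow> ('p, 'n, 'b) cat_scheme \<Rightarrow>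
   ('o, 'm, 'p, 'n) functor_data \<Rightarrow> bool" where
  "bi_continuous small C D F \<longleftrightarrow>
     (\<forall>I A P \<iota>. small I \<and> (\<forall>i \<in> I. A i \<in> Obj C) \<and> is_coproduct C I A P \<iota> \<longrightarrow>
        is_coproduct D I (\<lambda>i. fobj F (A i)) (fobj F P) (\<lambda>i. farr F (\<iota> i))) \<and>
     (\<forall>I A P \<pi>. small I \<and> (\<forall>i \<in> I. A i \<in> Obj C) \<and> is_product C I A P \<pi> \<longrightarrow>
        is_product D I (\<lambda>i. fobj F (A i)) (fobj F P) (\<lambda>i. farr F (\<pi> i)))"


section \<open>Additive categories\<close>

record ('o, 'm) preadd_cat = "('o, 'm) cat" +
  Add :: "'m \<Rightarrow> 'm \<Rightarrow> 'm"
  Zero :: "'o \<Rightarrow> 'o \<Rightarrow> 'm"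

text \<open>The abelian group of morphisms, in the multiplicative signature of \<^theory>\<open>HOL-Algebra.Group\<close>.\<close>

definition Hom_group ::
  "('o, 'm, 'a) preadd_cat_scheme \<Rightarrow> 'o \<Rightarrow> 'o \<Rightarrow> 'm monoid" where
  "Hom_group C X Y = \<lparr>carrier = Hom C X Y, mult = Add C, one = Zero C X Y\<rparr>"

definition Neg :: "('o, 'm, 'a) preadd_cat_scheme \<Rightarrow> 'm \<Rightarrow> 'm" where
  "Neg C f = m_inv (Hom_group C (Dom C f) (Cod C f)) f"

definition is_zero_object :: "('o, 'm, 'a) cat_scheme \<Rightarrow> 'o \<Rightarrow> bool" where
  "is_zero_object C Z \<longleftrightarrow> Z \<in> Obj C \<and>
     (\<forall>X \<in> Obj C. (\<exists>!f. f \<in> Hom C X Z) \<and> (\<exists>!f. f \<in> Hom C Z X))"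

definition is_biproduct :: "('o, 'm, 'a) preadd_cat_scheme \<Rightarrow> 'o \<Rightarrow> 'o \<Rightarrow> 'o \<Rightarrow> bool" where
  "is_biproduct C X Y P \<longleftrightarrow> P \<in> Obj C \<and>
     (\<exists>i1 \<in> Hom C X P. \<exists>i2 \<in> Hom C Y P. \<exists>p1 \<in> Hom C P X. \<exists>p2 \<in> Hom C P Y.
        Comp C p1 i1 = Ident C X \<and> Comp C p2 i2 = Ident C Y \<and>
        Comp C p1 i2 = Zero C Y X \<and> Comp C p2 i1 = Zero C X Y \<and>
        Add C (Comp C i1 p1) (Comp C i2 p2) = Ident C P)"

text \<open>Full subcategories are represented by their sets of objects.\<close>

definition full_additive_subcategory :: "('o, 'm, 'a) preadd_cat_scheme \<Rightarrow> 'o set \<Rightarrow> bool" where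
  "full_additive_subcategory C A \<longleftrightarrow> A \<subseteq> Obj C \<and>
     (\<exists>Z \<in> A. is_zero_object C Z) \<and>
     (\<forall>X \<in> A. \<forall>Y \<in> A. \<exists>P \<in> A. is_biproduct C X Y P)"

locale additive_category = category C
  for C :: "('o, 'm, 'a) preadd_cat_scheme" +
  assumes hom_comm_group: "X \<in> Obj C \<Longrightarrow> Y \<in> Obj C \<Longrightarrow> comm_group (Hom_group C X Y)"
    and comp_add_right: "f \<in> Hom C X Y \<Longrightarrow> f' \<in> Hom C X Y \<Longrightarrow> g \<in> Hom C Y Z \<Longrightarrow>
      Comp C g (Add C f f') = Add C (Comp C g f) (Comp C g f')"
    and comp_add_left: "f \<in> Hom C X Y \<Longrightarrow> g \<in> Hom C Y Z \<Longrightarrow> g' \<in> Hom C Y Z \<Longrightarrow>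
      Comp C (Add C g g') f = Add C (Comp C g f) (Comp C g' f)"
    and ex_zero_object: "\<exists>Z. is_zero_object C Z"
    and ex_biproduct: "X \<in> Obj C \<Longrightarrow> Y \<in> Obj C \<Longrightarrow> \<exists>P. is_biproduct C X Y P"

definition additive_functor ::
  "('o, 'm, 'a) preadd_cat_scheme \<Rightarrow> ('p, 'n, 'b) preadd_cat_scheme \<Rightarrow>
   ('o, 'm, 'p, 'n) functor_data \<Rightarrow> bool" where
  "additive_functor C D F \<longleftrightarrow> is_functor C D F \<and>
     (\<forall>X Y. \<forall>f \<in> Hom C X Y. \<forall>g \<in> Hom C X Y. farr F (Add C f g) = Add D (farr F f) (farr F g))"

definition Hom_zero :: "('o, 'm, 'a) preadd_cat_scheme \<Rightarrow> 'o set \<Rightarrow> 'o set \<Rightarrow> bool" where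
  "Hom_zero C A B \<longleftrightarrow> (\<forall>X \<in> A. \<forall>Y \<in> B. Hom C X Y = {Zero C X Y})"


section \<open>Triangulated categories\<close>

record ('o, 'm) tri_cat = "('o, 'm) preadd_cat" +
  Susp :: "('o, 'm, 'o, 'm) functor_data"
  Tri :: "('m \<times> 'm \<times> 'm) set"

abbreviation SuspO :: "('o, 'm, 'a) tri_cat_scheme \<Rightarrow> 'o \<Rightarrow> 'o" where
  "SuspO T \<equiv> fobj (Susp T)"

abbreviation SuspM :: "('o, 'm, 'a) tri_cat_scheme \<Rightarrow> 'm \<Rightarrow> 'm" where
  "SuspM T \<equiv> farr (Susp T)"

definition triangle ::
  "('o, 'm, 'a) tri_cat_scheme \<Rightarrow> 'o \<Rightarrow> 'o \<Rightarrow> 'o \<Rightarrow> 'm \<Rightarrow> 'm \<Rightarrow> 'm \<Rightarrow> bool" where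
  "triangle T X Y Z u v w \<longleftrightarrow>
     u \<in> Hom T X Y \<and> v \<in> Hom T Y Z \<and> w \<in> Hom T Z (SuspO T X)"

definition exact_triangle ::
  "('o, 'm, 'a) tri_cat_scheme \<Rightarrow> 'o \<Rightarrow> 'o \<Rightarrow> 'o \<Rightarrow> 'm \<Rightarrow> 'm \<Rightarrow> 'm \<Rightarrow> bool" where
  "exact_triangle T X Y Z u v w \<longleftrightarrow> triangle T X Y Z u v w \<and> (u, v, w) \<in> Tri T"

text \<open>Verdier's axioms TR1 to TR4; the suspension is only required to be an auto-equivalence.\<close>

locale triangulated_category = additive_category T
  for T :: "('o, 'm, 'a) tri_cat_scheme" +
  assumes susp_additive: "additive_functor T T (Susp T)"
    and susp_equivalence: "is_equivalence T T (Susp T)"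
    and tri_wf: "(u, v, w) \<in> Tri T \<Longrightarrow> \<exists>X Y Z. triangle T X Y Z u v w"
    and TR1_iso: "exact_triangle T X Y Z u v w \<Longrightarrow> triangle T X' Y' Z' u' v' w' \<Longrightarrow>
      is_iso T X X' a \<Longrightarrow> is_iso T Y Y' b \<Longrightarrow> is_iso T Z Z' c \<Longrightarrow>
      Comp T b u = Comp T u' a \<Longrightarrow> Comp T c v = Comp T v' b \<Longrightarrow>
      Comp T (SuspM T a) w = Comp T w' c \<Longrightarrow> exact_triangle T X' Y' Z' u' v' w'"
    and TR1_ident: "X \<in> Obj T \<Longrightarrow> is_zero_object T Z \<Longrightarrow>
      exact_triangle T X X Z (Ident T X) (Zero T X Z) (Zero T Z (SuspO T X))"
    and TR1_cone: "u \<in> Hom T X Y \<Longrightarrow> \<exists>Z v w. exact_triangle T X Y Z u v w"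
    and TR2: "triangle T X Y Z u v w \<Longrightarrow>
      exact_triangle T X Y Z u v w \<longleftrightarrow>
      exact_triangle T Y Z (SuspO T X) v w (Neg T (SuspM T u))"
    and TR3: "exact_triangle T X Y Z u v w \<Longrightarrow> exact_triangle T X' Y' Z' u' v' w' \<Longrightarrow>
      a \<in> Hom T X X' \<Longrightarrow> b \<in> Hom T Y Y' \<Longrightarrow> Comp T b u = Comp T u' a \<Longrightarrow>
      \<exists>c \<in> Hom T Z Z'. Comp T c v = Comp T v' b \<and> Comp T (SuspM T a) w = Comp T w' c"
    and TR4: "exact_triangle T X Y Z' f j k \<Longrightarrow> exact_triangle T Y Z X' g l i \<Longrightarrow>
      exact_triangle T X Z Y' (Comp T g f) m n \<Longrightarrow>
      \<exists>u v. exact_triangle T Z' Y' X' u v (Comp T (SuspM T j) i) \<and>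
        Comp T u j = Comp T m g \<and> Comp T n u = k \<and>
        Comp T v m = l \<and> Comp T i v = Comp T (SuspM T f) n"

text \<open>A triangle functor is a functor \<open>F\<close> together with a natural isomorphism
  \<open>\<omega> : F \<circ> \<Sigma> \<cong> \<Sigma>' \<circ> F\<close>.\<close>

definition triangle_functor ::
  "('o, 'm, 'a) tri_cat_scheme \<Rightarrow> ('p, 'n, 'b) tri_cat_scheme \<Rightarrow>
   ('o, 'm, 'p, 'n) functor_data \<Rightarrow> ('o \<Rightarrow> 'n) \<Rightarrow> bool" where
  "triangle_functor T T' F \<omega> \<longleftrightarrow> additive_functor T T' F \<and>
     natural_iso T T' (comp_functor F (Susp T)) (comp_functor (Susp T') F) \<omega> \<and>
     (\<forall>X Y Z u v w. exact_triangle T X Y Z u v w \<longrightarrow>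
        exact_triangle T' (fobj F X) (fobj F Y) (fobj F Z)
          (farr F u) (farr F v) (Comp T' (\<omega> X) (farr F w)))"

text \<open>\<open>susp_pow T n A\<close> is \<open>\<Sigma>\<^sup>n(A)\<close> for an integer \<open>n\<close>, as a full subcategory closed under
  isomorphism. For negative \<open>n\<close> this is the essential image of \<open>A\<close> under the corresponding power
  of any quasi-inverse of \<open>\<Sigma>\<close>.\<close>

definition susp_pow :: "('o, 'm, 'a) tri_cat_scheme \<Rightarrow> int \<Rightarrow> 'o set \<Rightarrow> 'o set" where
  "susp_pow T n A =
     (if 0 \<le> n then {Y \<in> Obj T. \<exists>X \<in> A. isomorphic T ((SuspO T ^^ nat n) X) Y}
      else {Y \<in> Obj T. \<exists>X \<in> A. isomorphic T X ((SuspO T ^^ nat (- n)) Y)})"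

definition star :: "('o, 'm, 'a) tri_cat_scheme \<Rightarrow> 'o set \<Rightarrow> 'o set \<Rightarrow> 'o set" where
  "star T A B = {Z \<in> Obj T. \<exists>X \<in> A. \<exists>Y \<in> B. \<exists>u v w. exact_triangle T X Z Y u v w}"

definition triangulated_subcategory :: "('o, 'm, 'a) tri_cat_scheme \<Rightarrow> 'o set \<Rightarrow> bool" where
  "triangulated_subcategory T L \<longleftrightarrow> full_additive_subcategory T L \<and>
     (\<forall>X \<in> L. \<forall>Y. isomorphic T X Y \<longrightarrow> Y \<in> L) \<and>
     susp_pow T 1 L \<subseteq> L \<and> susp_pow T (-1) L \<subseteq> L \<and>
     (\<forall>X Y Z u v w. exact_triangle T X Y Z u v w \<and> X \<in> L \<and> Y \<in> L \<longrightarrow> Z \<in> L)"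

definition Loc :: "('i set \<Rightarrow> bool) \<Rightarrow> ('o, 'm, 'a) tri_cat_scheme \<Rightarrow> 'o set \<Rightarrow> 'o set" where
  "Loc small T S = \<Inter> {L. triangulated_subcategory T L \<and> S \<subseteq> L \<and>
     (\<forall>I A P \<iota>. small I \<and> (\<forall>i \<in> I. A i \<in> L) \<and> is_coproduct T I A P \<iota> \<longrightarrow> P \<in> L)}"

definition coLoc :: "('i set \<Rightarrow> bool) \<Rightarrow> ('o, 'm, 'a) tri_cat_scheme \<Rightarrow> 'o set \<Rightarrow> 'o set" where
  "coLoc small T S = \<Inter> {L. triangulated_subcategory T L \<and> S \<subseteq> L \<and>
     (\<forall>I A P \<pi>. small I \<and> (\<forall>i \<in> I. A i \<in> L) \<and> is_product T I A P \<pi> \<longrightarrow> P \<in> L)}"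


section \<open>Pre-weight structures\<close>

text \<open>Throughout, \<open>U\<close> stands for \<open>\<U>\<^bsub>\<ge>0\<^esub>\<close> and \<open>V\<close> for \<open>\<U>\<^bsub>\<le>0\<^esub>\<close>.\<close>

definition pre_weight_structure ::
  "('o, 'm, 'a) tri_cat_scheme \<Rightarrow> 'o set \<Rightarrow> 'o set \<Rightarrow> bool" where
  "pre_weight_structure T U V \<longleftrightarrow>
     full_additive_subcategory T U \<and> full_additive_subcategory T V \<and>
     star T U (susp_pow T 1 V) = Obj T \<and>
     susp_pow T (-1) U \<subseteq> U \<and> star T U U \<subseteq> U \<and>
     susp_pow T 1 V \<subseteq> V \<and> star T V V \<subseteq> V"

text \<open>\<open>level T U m\<close> is \<open>\<U>\<^bsub>\<ge>m\<^esub>\<close>, and \<open>level T V m\<close> is \<open>\<U>\<^bsub>\<le>m\<^esub>\<close>: both are defined as \<open>\<Sigma>\<close> to the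
  power \<open>-m\<close> of the respective class.\<close>

definition level :: "('o, 'm, 'a) tri_cat_scheme \<Rightarrow> 'o set \<Rightarrow> int \<Rightarrow> 'o set" where
  "level T A m = susp_pow T (- m) A"

definition interval_part ::
  "('o, 'm, 'a) tri_cat_scheme \<Rightarrow> 'o set \<Rightarrow> 'o set \<Rightarrow> int \<Rightarrow> int \<Rightarrow> 'o set" where
  "interval_part T U V m n = level T U m \<inter> level T V n"

definition bounded_part :: "('o, 'm, 'a) tri_cat_scheme \<Rightarrow> 'o set \<Rightarrow> 'o set \<Rightarrow> 'o set" where
  "bounded_part T U V = \<Union> {interval_part T U V m n | m n. m \<le> n}"

text \<open>The infimum is attained unless the set is empty, in which case it is \<open>\<infinity>\<close>.\<close>

definition pws_dimension :: "('o, 'm, 'a) tri_cat_scheme \<Rightarrow> 'o set \<Rightarrow> 'o set \<Rightarrow> ereal" where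
  "pws_dimension T U V =
     Inf {ereal (real_of_int d) | d. d \<ge> -1 \<and> Hom_zero T U (level T V (- (d + 1)))}"

definition bounded_functor ::
  "('o, 'm, 'a) tri_cat_scheme \<Rightarrow> ('p, 'n, 'b) tri_cat_scheme \<Rightarrow>
   ('o, 'm, 'p, 'n) functor_data \<Rightarrow> 'o set \<Rightarrow> 'o set \<Rightarrow> bool" where
  "bounded_functor T T' F U V \<longleftrightarrow>
     (\<exists>n0 :: nat. Hom_zero T' (fobj F ` U) (fobj F ` level T V (- int n0)))"

end

theory Submission
  imports Defs
begin

text \<open>Call a pair \<open>(X, Y)\<close> good if \<open>F\<close> is bijective on \<open>Hom(X, Y)\<close>. For a class \<open>W\<close> stable under
  \<open>\<Sigma>\<close> and its inverse, the objects \<open>X\<close> such that \<open>(X, Y)\<close> is good for all \<open>Y\<close> in \<open>W\<close> form, by the five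
  lemma, a triangulated subcategory closed under coproducts; dually for products in the second
  variable. If \<open>X \<in> \<U>\<^bsub>\<ge>m\<^esub>\<close> and \<open>Y \<in> \<U>\<^bsub>\<le>n\<^esub>\<close> with \<open>n\<close> much smaller than \<open>m\<close>, then \<open>(X, Y)\<close> is
  good because both Hom groups vanish. Decomposing the second variable after a large shift, this
  extends goodness of pairs \<open>(\<U>\<^sub>b, \<U>\<^bsub>\<ge>0\<^esub>)\<close>, which holds by passing to \<open>coLoc\<close>, to \<open>(\<U>\<^sub>b, \<T>)\<close>, whence to
  \<open>(\<U>\<^bsub>\<le>0\<^esub>, \<T>)\<close> by passing to \<open>Loc\<close>. Decomposing the first variable instead gives \<open>(\<T>, \<U>\<^sub>b)\<close>, hence
  \<open>(\<T>, \<U>\<^bsub>\<ge>0\<^esub>)\<close>, and decomposing the second variable once more gives \<open>(\<U>\<^bsub>\<ge>0\<^esub>, \<T>)\<close>. Every object is an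
  extension of an object of \<open>\<Sigma>(\<U>\<^bsub>\<le>0\<^esub>)\<close> by one of \<open>\<U>\<^bsub>\<ge>0\<^esub>\<close>.\<close>

section \<open>The five lemma\<close>

text \<open>Two four-lemma chases: triviality of the kernel of \<open>f3\<close> uses
  \<open>f1\<close> onto and \<open>f2\<close>, \<open>f4\<close> injective; surjectivity uses
  \<open>f2\<close>, \<open>f4\<close> onto and \<open>f5\<close> injective. Exactness is phrased as
  kernel equals image, the form in which triangles deliver Hom sequences below.\<close>

lemma five_lemma:
  assumes "group_hom A1 A2 a1" "group_hom A2 A3 a2" "group_hom A3 A4 a3" "group_hom A4 A5 a4"
    and "group_hom B1 B2 b1" "group_hom B2 B3 b2" "group_hom B3 B4 b3" "group_hom B4 B5 b4"
    and exA2: "\<And>x. x \<in> carrier A2 \<Longrightarrow> a2 x = \<one>\<^bsub>A3\<^esub> \<longleftrightarrow> x \<in> a1 ` carrier A1"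
    and exA3: "\<And>x. x \<in> carrier A3 \<Longrightarrow> a3 x = \<one>\<^bsub>A4\<^esub> \<longleftrightarrow> x \<in> a2 ` carrier A2"
    and exA4: "\<And>x. x \<in> carrier A4 \<Longrightarrow> a4 x = \<one>\<^bsub>A5\<^esub> \<longleftrightarrow> x \<in> a3 ` carrier A3"
    and exB2: "\<And>x. x \<in> carrier B2 \<Longrightarrow> b2 x = \<one>\<^bsub>B3\<^esub> \<longleftrightarrow> x \<in> b1 ` carrier B1"
    and exB3: "\<And>x. x \<in> carrier B3 \<Longrightarrow> b3 x = \<one>\<^bsub>B4\<^esub> \<longleftrightarrow> x \<in> b2 ` carrier B2"
    and exB4: "\<And>x. x \<in> carrier B4 \<Longrightarrow> b4 x = \<one>\<^bsub>B5\<^esub> \<longleftrightarrow> x \<in> b3 ` carrier B3"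
    and "group_hom A2 B2 f2" "group_hom A3 B3 f3" "group_hom A4 B4 f4" "group_hom A5 B5 f5"
    and f1: "f1 ` carrier A1 = carrier B1"
    and f2: "bij_betw f2 (carrier A2) (carrier B2)"
    and f4: "bij_betw f4 (carrier A4) (carrier B4)"
    and f5: "inj_on f5 (carrier A5)"
    and sq1: "\<And>x. x \<in> carrier A1 \<Longrightarrow> f2 (a1 x) = b1 (f1 x)"
    and sq2: "\<And>x. x \<in> carrier A2 \<Longrightarrow> f3 (a2 x) = b2 (f2 x)"
    and sq3: "\<And>x. x \<in> carrier A3 \<Longrightarrow> f4 (a3 x) = b3 (f3 x)"
    and sq4: "\<And>x. x \<in> carrier A4 \<Longrightarrow> f5 (a4 x) = b4 (f4 x)"
  shows "bij_betw f3 (carrier A3) (carrier B3)"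
proof -
  interpret a1: group_hom A1 A2 a1 by fact
  interpret a2: group_hom A2 A3 a2 by fact
  interpret a3: group_hom A3 A4 a3 by fact
  interpret a4: group_hom A4 A5 a4 by fact
  interpret b1: group_hom B1 B2 b1 by fact
  interpret b2: group_hom B2 B3 b2 by fact
  interpret b3: group_hom B3 B4 b3 by fact
  interpret b4: group_hom B4 B5 b4 by fact
  interpret f2: group_hom A2 B2 f2 by fact
  interpret f3: group_hom A3 B3 f3 by fact
  interpret f4: group_hom A4 B4 f4 by fact
  interpret f5: group_hom A5 B5 f5 by fact
  have f2s: "f2 ` carrier A2 = carrier B2" and f4s: "f4 ` carrier A4 = carrier B4"
    using f2 f4 by (auto simp: bij_betw_def)
  have f2i: "\<And>x y. x \<in> carrier A2 \<Longrightarrow> y \<in> carrier A2 \<Longrightarrow> f2 x = f2 y \<Longrightarrow> x = y"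
    and f4i: "\<And>x y. x \<in> carrier A4 \<Longrightarrow> y \<in> carrier A4 \<Longrightarrow> f4 x = f4 y \<Longrightarrow> x = y"
    and f5i: "\<And>x y. x \<in> carrier A5 \<Longrightarrow> y \<in> carrier A5 \<Longrightarrow> f5 x = f5 y \<Longrightarrow> x = y"
    using f2 f4 f5 by (auto simp: bij_betw_def inj_on_def)
  have "x = \<one>\<^bsub>A3\<^esub>" if x: "x \<in> carrier A3" "f3 x = \<one>\<^bsub>B3\<^esub>" for x
  proof -
    have "f4 (a3 x) = f4 \<one>\<^bsub>A4\<^esub>"
      using x by (simp add: sq3)
    then have "a3 x = \<one>\<^bsub>A4\<^esub>"
      using f4i x by simp
    then obtain y where y: "y \<in> carrier A2" "x = a2 y"
      using exA3 x by blast
    then have "b2 (f2 y) = \<one>\<^bsub>B3\<^esub>"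
      using sq2 x by simp
    then obtain w where w: "w \<in> carrier A1" "f2 y = b1 (f1 w)"
      using exB2 y f1 by (metis (no_types, lifting) f2.hom_closed imageE)
    then have "y = a1 w"
      using f2i[of y "a1 w"] sq1 y by simp
    then show ?thesis
      using exA2 w y by blast
  qed
  then have ker: "\<And>x. x \<in> carrier A3 \<Longrightarrow> f3 x = \<one>\<^bsub>B3\<^esub> \<Longrightarrow> x = \<one>\<^bsub>A3\<^esub>" .
  have inj: "x = y" if xy: "x \<in> carrier A3" "y \<in> carrier A3" "f3 x = f3 y" for x y
  proof -
    have "x \<otimes>\<^bsub>A3\<^esub> inv\<^bsub>A3\<^esub> y = \<one>\<^bsub>A3\<^esub>"
      by (rule ker) (use xy in auto)
    then show ?thesis
      using xy a2.H.inv_equality[of x "inv\<^bsub>A3\<^esub> y"] by simp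
  qed
  have "z \<in> f3 ` carrier A3" if z: "z \<in> carrier B3" for z
  proof -
    obtain y where y: "y \<in> carrier A4" "f4 y = b3 z"
      using f4s b3.hom_closed[OF z] by (metis imageE)
    have "b4 (b3 z) = \<one>\<^bsub>B5\<^esub>"
      using exB4[of "b3 z"] z by simp
    then have "f5 (a4 y) = f5 \<one>\<^bsub>A5\<^esub>"
      using sq4 y by simp
    then have "a4 y = \<one>\<^bsub>A5\<^esub>"
      using f5i y by simp
    then obtain x where x: "x \<in> carrier A3" "y = a3 x"
      using exA4 y by blast
    \<comment> \<open>\<open>f3 x\<close> and \<open>z\<close> have the same image under
      \<open>b3\<close>, so their quotient \<open>d\<close> comes from \<open>B2\<close>, hence from
      \<open>A2\<close> because \<open>f2\<close> is onto; \<open>x\<close> is then corrected by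
      that element.\<close>
    define d where "d = z \<otimes>\<^bsub>B3\<^esub> inv\<^bsub>B3\<^esub> (f3 x)"
    have d: "d \<in> carrier B3"
      using z x by (simp add: d_def)
    have "b3 (f3 x) = b3 z"
      using sq3[OF x(1)] x y by simp
    then have "b3 d = \<one>\<^bsub>B4\<^esub>"
      using z x by (simp add: d_def)
    then obtain v where v: "v \<in> carrier A2" "d = b2 (f2 v)"
      using exB3[OF d] f2s by (metis (no_types, lifting) imageE)
    have "z = d \<otimes>\<^bsub>B3\<^esub> f3 x"
      using z x by (simp add: d_def b2.H.m_assoc)
    also have "\<dots> = f3 (a2 v \<otimes>\<^bsub>A3\<^esub> x)"
      using v x sq2 by simp
    finally show ?thesis
      by (rule image_eqI) (use v x in simp)
  qed
  then show ?thesis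
    using inj f3.hom_closed by (auto simp: bij_betw_def inj_on_def)
qed

section \<open>Categories and functors\<close>

context category
begin

lemma hom_objs: "f \<in> Hom C X Y \<Longrightarrow> X \<in> Obj C \<and> Y \<in> Obj C"
  using dom_obj cod_obj by (auto simp: Hom_def)

lemma is_iso_ident: "X \<in> Obj C \<Longrightarrow> is_iso C X X (Ident C X)"
  unfolding is_iso_def using ident_hom comp_ident_left by blast

lemma isomorphic_refl: "X \<in> Obj C \<Longrightarrow> isomorphic C X X"
  unfolding isomorphic_def using is_iso_ident by blast

lemma isomorphic_sym: "isomorphic C X Y \<Longrightarrow> isomorphic C Y X"
  unfolding isomorphic_def is_iso_def by blast

lemma is_iso_comp:
  assumes "is_iso C X Y f" "is_iso C Y Z g"
  shows "is_iso C X Z (Comp C g f)"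
proof -
  obtain f' where f: "f \<in> Hom C X Y" "f' \<in> Hom C Y X"
      "Comp C f' f = Ident C X" "Comp C f f' = Ident C Y"
    using assms unfolding is_iso_def by blast
  obtain g' where g: "g \<in> Hom C Y Z" "g' \<in> Hom C Z Y"
      "Comp C g' g = Ident C Y" "Comp C g g' = Ident C Z"
    using assms unfolding is_iso_def by blast
  have "Comp C (Comp C f' g') (Comp C g f) = Ident C X"
    using f g comp_assoc[OF comp_hom[OF f(1) g(1)] g(2) f(2)] comp_assoc[OF f(1) g(1) g(2)]
      comp_ident_left[OF f(1)] by simp
  moreover have "Comp C (Comp C g f) (Comp C f' g') = Ident C Z"
    using f g comp_assoc[OF comp_hom[OF g(2) f(2)] f(1) g(1)] comp_assoc[OF g(2) f(2) f(1)]
      comp_ident_left[OF g(2)] by simp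
  ultimately show ?thesis
    unfolding is_iso_def using f g comp_hom by blast
qed

lemma isomorphic_trans: "isomorphic C X Y \<Longrightarrow> isomorphic C Y Z \<Longrightarrow> isomorphic C X Z"
  unfolding isomorphic_def using is_iso_comp by blast

lemma isomorphic_objs: "isomorphic C X Y \<Longrightarrow> X \<in> Obj C \<and> Y \<in> Obj C"
  unfolding isomorphic_def is_iso_def using hom_objs by blast

lemma bij_betw_precomp:
  assumes "is_iso C X X' \<phi>"
  shows "bij_betw (\<lambda>f. Comp C f \<phi>) (Hom C X' Y) (Hom C X Y)"
proof -
  obtain \<psi> where *: "\<phi> \<in> Hom C X X'" "\<psi> \<in> Hom C X' X"
      "Comp C \<psi> \<phi> = Ident C X" "Comp C \<phi> \<psi> = Ident C X'"
    using assms unfolding is_iso_def by blast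
  show ?thesis
    by (rule bij_betw_byWitness[where f' = "\<lambda>f. Comp C f \<psi>"])
      (auto simp: * comp_hom[OF *(1)] comp_hom[OF *(2)] comp_ident_right
        comp_assoc[OF *(1) *(2), symmetric] comp_assoc[OF *(2) *(1), symmetric])
qed

lemma bij_betw_postcomp:
  assumes "is_iso C Y Y' \<phi>"
  shows "bij_betw (\<lambda>f. Comp C \<phi> f) (Hom C X Y) (Hom C X Y')"
proof -
  obtain \<psi> where *: "\<phi> \<in> Hom C Y Y'" "\<psi> \<in> Hom C Y' Y"
      "Comp C \<psi> \<phi> = Ident C Y" "Comp C \<phi> \<psi> = Ident C Y'"
    using assms unfolding is_iso_def by blast
  show ?thesis
    by (rule bij_betw_byWitness[where f' = "\<lambda>f. Comp C \<psi> f"])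
      (auto simp: * comp_hom[OF _ *(1)] comp_hom[OF _ *(2)] comp_ident_left
        comp_assoc[OF _ *(1) *(2)] comp_assoc[OF _ *(2) *(1)])
qed

lemma is_iso_cancel_left:
  "is_iso C Y Y' \<phi> \<Longrightarrow> f \<in> Hom C X Y \<Longrightarrow> g \<in> Hom C X Y \<Longrightarrow> Comp C \<phi> f = Comp C \<phi> g \<Longrightarrow> f = g"
  using bij_betw_postcomp[of Y Y' \<phi> X] by (auto simp: bij_betw_def inj_on_def)

lemma is_iso_cancel_right:
  "is_iso C X X' \<phi> \<Longrightarrow> f \<in> Hom C X' Y \<Longrightarrow> g \<in> Hom C X' Y \<Longrightarrow> Comp C f \<phi> = Comp C g \<phi> \<Longrightarrow> f = g"
  using bij_betw_precomp[of X X' \<phi> Y] by (auto simp: bij_betw_def inj_on_def)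

end

section \<open>Functors and the pairs of objects on which they are bijective\<close>

lemma functor_obj: "is_functor C D F \<Longrightarrow> X \<in> Obj C \<Longrightarrow> fobj F X \<in> Obj D"
  and functor_hom: "is_functor C D F \<Longrightarrow> f \<in> Hom C X Y \<Longrightarrow> farr F f \<in> Hom D (fobj F X) (fobj F Y)"
  and functor_ident: "is_functor C D F \<Longrightarrow> X \<in> Obj C \<Longrightarrow> farr F (Ident C X) = Ident D (fobj F X)"
  and functor_comp: "is_functor C D F \<Longrightarrow> f \<in> Hom C X Y \<Longrightarrow> g \<in> Hom C Y Z \<Longrightarrow>
    farr F (Comp C g f) = Comp D (farr F g) (farr F f)"
  unfolding is_functor_def by blast+

lemma (in category) functor_is_iso:
  assumes F: "is_functor C D F" and "is_iso C X Y f"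
  shows "is_iso D (fobj F X) (fobj F Y) (farr F f)"
proof -
  obtain g where f: "f \<in> Hom C X Y" "g \<in> Hom C Y X"
      "Comp C g f = Ident C X" "Comp C f g = Ident C Y"
    using assms unfolding is_iso_def by blast
  have "X \<in> Obj C" "Y \<in> Obj C"
    using f hom_objs by blast+
  then show ?thesis
    unfolding is_iso_def using f functor_hom[OF F] functor_ident[OF F]
    by (metis functor_comp[OF F])
qed

lemma (in category) functor_isomorphic:
  "is_functor C D F \<Longrightarrow> isomorphic C X Y \<Longrightarrow> isomorphic D (fobj F X) (fobj F Y)"
  unfolding isomorphic_def using functor_is_iso by blast

text \<open>Goodness of a pair. It is stated for single pairs, not for classes, because the closure
  arguments vary one object while the other one is held fixed.\<close>

definition hom_bij ::
  "('o, 'm, 'a) cat_scheme \<Rightarrow> ('p, 'n, 'b) cat_scheme \<Rightarrow> ('o, 'm, 'p, 'n) functor_data \<Rightarrow>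
   'o \<Rightarrow> 'o \<Rightarrow> bool" where
  "hom_bij C D F X Y \<longleftrightarrow> bij_betw (farr F) (Hom C X Y) (Hom D (fobj F X) (fobj F Y))"

lemma fully_faithful_on_iff: "fully_faithful_on C D F A \<longleftrightarrow> (\<forall>X\<in>A. \<forall>Y\<in>A. hom_bij C D F X Y)"
  by (simp add: fully_faithful_on_def hom_bij_def)

lemma hom_bij_inj:
  "hom_bij C D F X Y \<Longrightarrow> f \<in> Hom C X Y \<Longrightarrow> g \<in> Hom C X Y \<Longrightarrow> farr F f = farr F g \<Longrightarrow> f = g"
  by (auto simp: hom_bij_def bij_betw_def inj_on_def)

lemma hom_bij_surj:
  assumes "hom_bij C D F X Y" "h \<in> Hom D (fobj F X) (fobj F Y)"
  obtains f where "f \<in> Hom C X Y" "farr F f = h"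
proof -
  have "h \<in> farr F ` Hom C X Y"
    using assms by (simp add: hom_bij_def bij_betw_def)
  then show thesis
    using that by blast
qed

lemma hom_bijI:
  assumes "is_functor C D F"
    and "\<And>f g. f \<in> Hom C X Y \<Longrightarrow> g \<in> Hom C X Y \<Longrightarrow> farr F f = farr F g \<Longrightarrow> f = g"
    and "\<And>h. h \<in> Hom D (fobj F X) (fobj F Y) \<Longrightarrow> \<exists>f\<in>Hom C X Y. farr F f = h"
  shows "hom_bij C D F X Y"
  unfolding hom_bij_def bij_betw_def inj_on_def using assms functor_hom[OF assms(1)]
  by (auto simp: image_iff) metis

lemma bij_betw_square:
  assumes "bij_betw f A B" "bij_betw g A C" "bij_betw h C D"
    and "\<And>x. x \<in> A \<Longrightarrow> k (f x) = h (g x)"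
  shows "bij_betw k B D"
proof -
  have "bij_betw (k \<circ> f) A D"
    using bij_betw_trans[OF assms(2,3)] assms(4) by (subst bij_betw_cong) auto
  then show ?thesis
    using assms(1) bij_betw_comp_iff by blast
qed

text \<open>Precomposition with an isomorphism and with its image under \<open>F\<close> are
  bijections, and functoriality makes them commute with \<open>F\<close>.\<close>

lemma hom_bij_iso_left:
  assumes "category C" "category D" "is_functor C D F"
    and "isomorphic C X X'" "hom_bij C D F X Y"
  shows "hom_bij C D F X' Y"
proof -
  interpret C: category C by fact
  interpret D: category D by fact
  obtain \<phi> where \<phi>: "is_iso C X' X \<phi>"
    using assms(4) C.isomorphic_sym unfolding isomorphic_def by blast
  show ?thesis
    unfolding hom_bij_def
  proof (rule bij_betw_square)
    show "bij_betw (\<lambda>f. Comp C f \<phi>) (Hom C X Y) (Hom C X' Y)"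
      by (rule C.bij_betw_precomp[OF \<phi>])
    show "bij_betw (farr F) (Hom C X Y) (Hom D (fobj F X) (fobj F Y))"
      using assms(5) by (simp add: hom_bij_def)
    show "bij_betw (\<lambda>f. Comp D f (farr F \<phi>)) (Hom D (fobj F X) (fobj F Y))
        (Hom D (fobj F X') (fobj F Y))"
      by (rule D.bij_betw_precomp[OF C.functor_is_iso[OF assms(3) \<phi>]])
    show "\<And>f. f \<in> Hom C X Y \<Longrightarrow> farr F (Comp C f \<phi>) = Comp D (farr F f) (farr F \<phi>)"
      using \<phi> functor_comp[OF assms(3)] unfolding is_iso_def by blast
  qed
qed

lemma hom_bij_iso_right:
  assumes "category C" "category D" "is_functor C D F"
    and "isomorphic C Y Y'" "hom_bij C D F X Y"
  shows "hom_bij C D F X Y'"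
proof -
  interpret C: category C by fact
  interpret D: category D by fact
  obtain \<phi> where \<phi>: "is_iso C Y Y' \<phi>"
    using assms(4) unfolding isomorphic_def by blast
  show ?thesis
    unfolding hom_bij_def
  proof (rule bij_betw_square)
    show "bij_betw (\<lambda>f. Comp C \<phi> f) (Hom C X Y) (Hom C X Y')"
      by (rule C.bij_betw_postcomp[OF \<phi>])
    show "bij_betw (farr F) (Hom C X Y) (Hom D (fobj F X) (fobj F Y))"
      using assms(5) by (simp add: hom_bij_def)
    show "bij_betw (\<lambda>f. Comp D (farr F \<phi>) f) (Hom D (fobj F X) (fobj F Y))
        (Hom D (fobj F X) (fobj F Y'))"
      by (rule D.bij_betw_postcomp[OF C.functor_is_iso[OF assms(3) \<phi>]])
    show "\<And>f. f \<in> Hom C X Y \<Longrightarrow> farr F (Comp C \<phi> f) = Comp D (farr F \<phi>) (farr F f)"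
      using \<phi> functor_comp[OF assms(3)] unfolding is_iso_def by blast
  qed
qed

text \<open>By naturality \<open>farr F f\<close> determines the composite of
  \<open>\<eta> Y\<close> with \<open>f\<close>, and \<open>\<eta> Y\<close> can be cancelled. Only
  the unit enters, so the same argument serves the quasi-inverse once the counit is
  reversed.\<close>

lemma natural_iso_faithful:
  assumes "category C" "is_functor C D F" "natural_iso C C id_functor (comp_functor G F) \<eta>"
    and fg: "f \<in> Hom C X Y" "g \<in> Hom C X Y" and eq: "farr F f = farr F g"
  shows "f = g"
proof -
  interpret C: category C by fact
  have Y: "is_iso C Y (fobj G (fobj F Y)) (\<eta> Y)"
    using assms(3) C.hom_objs[OF fg(1)] by (auto simp: natural_iso_def id_functor_def comp_functor_def)
  have "Comp C (\<eta> Y) f = Comp C (\<eta> Y) g"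
    using assms(3) fg eq by (simp add: natural_iso_def id_functor_def comp_functor_def)
  then show ?thesis
    using C.is_iso_cancel_left[OF Y fg] by simp
qed

text \<open>The counit of an equivalence points towards the identity, while
  \<open>natural_iso_faithful\<close> wants an isomorphism starting there; this reverses it.\<close>

lemma natural_iso_inverse:
  assumes "category C" "category D" "is_functor C D F" "is_functor C D G" "natural_iso C D F G \<eta>"
  shows "\<exists>\<theta>. natural_iso C D G F \<theta>"
proof -
  interpret C: category C by fact
  interpret D: category D by fact
  have "\<forall>X\<in>Obj C. \<exists>t. t \<in> Hom D (fobj G X) (fobj F X) \<and>
      Comp D t (\<eta> X) = Ident D (fobj F X) \<and> Comp D (\<eta> X) t = Ident D (fobj G X)"
    using assms(5) unfolding natural_iso_def is_iso_def by blast
  then obtain \<theta> where \<theta>: "\<And>X. X \<in> Obj C \<Longrightarrow> \<theta> X \<in> Hom D (fobj G X) (fobj F X) \<and>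
      Comp D (\<theta> X) (\<eta> X) = Ident D (fobj F X) \<and> Comp D (\<eta> X) (\<theta> X) = Ident D (fobj G X)"
    by metis
  have \<eta>: "\<And>X. X \<in> Obj C \<Longrightarrow> \<eta> X \<in> Hom D (fobj F X) (fobj G X)"
    and nat: "\<And>X Y f. f \<in> Hom C X Y \<Longrightarrow> Comp D (\<eta> Y) (farr F f) = Comp D (farr G f) (\<eta> X)"
    using assms(5) unfolding natural_iso_def is_iso_def by auto
  have "Comp D (\<theta> Y) (farr G f) = Comp D (farr F f) (\<theta> X)" if f: "f \<in> Hom C X Y" for X Y f
  proof -
    have X: "X \<in> Obj C" and Y: "Y \<in> Obj C"
      using C.hom_objs[OF f] by auto
    note Ff = functor_hom[OF assms(3) f] and Gf = functor_hom[OF assms(4) f]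
    note tX = \<theta>[OF X] and tY = \<theta>[OF Y] and eX = \<eta>[OF X] and eY = \<eta>[OF Y]
    have "Comp D (Comp D (\<theta> Y) (farr G f)) (\<eta> X) = Comp D (\<theta> Y) (Comp D (\<eta> Y) (farr F f))"
      using nat[OF f] D.comp_assoc[OF eX Gf, of "\<theta> Y" "fobj F Y"] tY by simp
    also have "\<dots> = farr F f"
      using D.comp_assoc[OF Ff eY, of "\<theta> Y" "fobj F Y"] tY D.comp_ident_left[OF Ff] by simp
    also have "\<dots> = Comp D (Comp D (farr F f) (\<theta> X)) (\<eta> X)"
      using D.comp_assoc[OF eX _ Ff] tX D.comp_ident_right[OF Ff] by metis
    finally have *: "Comp D (Comp D (\<theta> Y) (farr G f)) (\<eta> X) = Comp D (Comp D (farr F f) (\<theta> X)) (\<eta> X)" .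
    have "is_iso D (fobj F X) (fobj G X) (\<eta> X)"
      using assms(5) X unfolding natural_iso_def by blast
    then show ?thesis
      by (rule D.is_iso_cancel_right) (use * Ff Gf tX tY D.comp_hom in blast)+
  qed
  moreover have "is_iso D (fobj G X) (fobj F X) (\<theta> X)" if "X \<in> Obj C" for X
    unfolding is_iso_def using \<theta>[OF that] \<eta>[OF that] by blast
  ultimately show ?thesis
    unfolding natural_iso_def by blast
qed

lemma functor_id: "category C \<Longrightarrow> is_functor C C id_functor"
  unfolding is_functor_def id_functor_def by simp

lemma functor_comp_functor:
  "is_functor C D F \<Longrightarrow> is_functor D E G \<Longrightarrow> is_functor C E (comp_functor G F)"
  unfolding is_functor_def comp_functor_def by simp blast

lemma equivalence_hom_bij:
  assumes "category C" "category D" "is_equivalence C D F" and X: "X \<in> Obj C" and Y: "Y \<in> Obj C"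
  shows "hom_bij C D F X Y"
proof -
  interpret C: category C by fact
  interpret D: category D by fact
  obtain G \<eta> \<epsilon> where F: "is_functor C D F" and G: "is_functor D C G"
    and \<eta>: "natural_iso C C id_functor (comp_functor G F) \<eta>"
    and \<epsilon>: "natural_iso D D (comp_functor F G) id_functor \<epsilon>"
    using assms(3) unfolding is_equivalence_def by blast
  obtain \<theta> where \<theta>: "natural_iso D D id_functor (comp_functor F G) \<theta>"
    using natural_iso_inverse[OF assms(2,2) functor_comp_functor[OF G F] functor_id[OF assms(2)] \<epsilon>]
    by blast
  show ?thesis
  proof (rule hom_bijI[OF F natural_iso_faithful[OF assms(1) F \<eta>]])
    fix h assume h: "h \<in> Hom D (fobj F X) (fobj F Y)"
    have iX: "is_iso C X (fobj G (fobj F X)) (\<eta> X)" and iY: "is_iso C Y (fobj G (fobj F Y)) (\<eta> Y)"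
      using \<eta> X Y by (auto simp: natural_iso_def id_functor_def comp_functor_def)
    \<comment> \<open>The preimage of \<open>h\<close> is the conjugate of \<open>farr G h\<close>
      by the unit. Its image under \<open>F\<close> agrees with \<open>h\<close> after applying
      \<open>G\<close>, and \<open>G\<close> is faithful by the reversed counit.\<close>
    have "Comp C (farr G h) (\<eta> X) \<in> Hom C X (fobj G (fobj F Y))"
      using functor_hom[OF G h] iX C.comp_hom unfolding is_iso_def by blast
    then obtain f where f: "f \<in> Hom C X Y" "Comp C (\<eta> Y) f = Comp C (farr G h) (\<eta> X)"
      using C.bij_betw_postcomp[OF iY, of X] unfolding bij_betw_def by (metis (no_types, lifting) imageE)
    moreover have "Comp C (\<eta> Y) f = Comp C (farr G (farr F f)) (\<eta> X)"
      using \<eta> f by (simp add: natural_iso_def id_functor_def comp_functor_def)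
    ultimately have "farr G (farr F f) = farr G h"
      using C.is_iso_cancel_right[OF iX functor_hom[OF G functor_hom[OF F f(1)]] functor_hom[OF G h]]
      by simp
    then have "farr F f = h"
      using natural_iso_faithful[OF assms(2) G \<theta> functor_hom[OF F f(1)] h] by simp
    then show "\<exists>f\<in>Hom C X Y. farr F f = h"
      using f by blast
  qed
qed

lemma equivalence_essentially_surjective:
  assumes "is_equivalence C D F" "Y \<in> Obj D"
  shows "\<exists>X\<in>Obj C. isomorphic D (fobj F X) Y"
proof -
  obtain G \<epsilon> where G: "is_functor D C G"
    and \<epsilon>: "natural_iso D D (comp_functor F G) id_functor \<epsilon>"
    using assms unfolding is_equivalence_def by blast
  have "is_iso D (fobj F (fobj G Y)) Y (\<epsilon> Y)"
    using \<epsilon> assms(2) by (simp add: natural_iso_def comp_functor_def id_functor_def)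
  then show ?thesis
    using functor_obj[OF G assms(2)] unfolding isomorphic_def by blast
qed

section \<open>Closure under biproducts, coproducts and products\<close>

text \<open>A morphism out of \<open>P\<close> is the same as a family of morphisms out of the
  \<open>A i\<close>, and likewise for the image of \<open>P\<close> because \<open>F\<close> keeps
  it a coproduct. Goodness of the pairs \<open>(A i, Y)\<close> matches the two kinds of
  families.\<close>

lemma hom_bij_coproduct:
  assumes "is_functor C D F" and co: "is_coproduct C I A P \<iota>"
    and co': "is_coproduct D I (\<lambda>i. fobj F (A i)) (fobj F P) (\<lambda>i. farr F (\<iota> i))"
    and Y: "Y \<in> Obj C" and ff: "\<And>i. i \<in> I \<Longrightarrow> hom_bij C D F (A i) Y"
    and "category C" "category D"
  shows "hom_bij C D F P Y"
proof -
  note F = assms(1)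
  interpret C: category C by fact
  interpret D: category D by fact
  have \<iota>: "\<And>i. i \<in> I \<Longrightarrow> \<iota> i \<in> Hom C (A i) P"
    using co unfolding is_coproduct_def by blast
  note F\<iota> = functor_hom[OF F \<iota>]
  have uni: "\<exists>!h. h \<in> Hom C P Y \<and> (\<forall>i\<in>I. Comp C h (\<iota> i) = f i)"
    if "\<And>i. i \<in> I \<Longrightarrow> f i \<in> Hom C (A i) Y" for f
    using co Y that unfolding is_coproduct_def by blast
  have uni': "\<exists>!h. h \<in> Hom D (fobj F P) (fobj F Y) \<and> (\<forall>i\<in>I. Comp D h (farr F (\<iota> i)) = f i)"
    if "\<And>i. i \<in> I \<Longrightarrow> f i \<in> Hom D (fobj F (A i)) (fobj F Y)" for f
    using co' functor_obj[OF F Y] that unfolding is_coproduct_def by blast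
  show ?thesis
  proof (rule hom_bijI[OF F])
    fix f g assume fg: "f \<in> Hom C P Y" "g \<in> Hom C P Y" "farr F f = farr F g"
    have "Comp C f (\<iota> i) = Comp C g (\<iota> i)" if i: "i \<in> I" for i
      by (rule hom_bij_inj[OF ff[OF i]])
        (use fg \<iota>[OF i] C.comp_hom functor_comp[OF F \<iota>[OF i]] in auto)
    then show "f = g"
      using uni[OF C.comp_hom[OF \<iota> fg(1)]] fg(1,2) by (metis (no_types, lifting))
  next
    fix h assume h: "h \<in> Hom D (fobj F P) (fobj F Y)"
    have "\<forall>i\<in>I. \<exists>f. f \<in> Hom C (A i) Y \<and> farr F f = Comp D h (farr F (\<iota> i))"
      using hom_bij_surj[OF ff] D.comp_hom[OF F\<iota> h] by metis
    then obtain f where f: "\<And>i. i \<in> I \<Longrightarrow> f i \<in> Hom C (A i) Y"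
        "\<And>i. i \<in> I \<Longrightarrow> farr F (f i) = Comp D h (farr F (\<iota> i))"
      by metis
    obtain g where g: "g \<in> Hom C P Y" "\<And>i. i \<in> I \<Longrightarrow> Comp C g (\<iota> i) = f i"
      using uni[OF f(1)] by blast
    have "\<And>i. i \<in> I \<Longrightarrow> Comp D (farr F g) (farr F (\<iota> i)) = farr F (f i)"
      using g functor_comp[OF F \<iota> g(1)] by simp
    then have "farr F g = h"
      using uni'[of "\<lambda>i. farr F (f i)"] h functor_hom[OF F g(1)] functor_hom[OF F f(1)] f(2) by metis
    then show "\<exists>f\<in>Hom C P Y. farr F f = h"
      using g by blast
  qed
qed

text \<open>The dual argument, with families of morphisms into the factors.\<close>

lemma hom_bij_product:
  assumes "is_functor C D F" and pr: "is_product C I A P \<pi>"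
    and pr': "is_product D I (\<lambda>i. fobj F (A i)) (fobj F P) (\<lambda>i. farr F (\<pi> i))"
    and X: "X \<in> Obj C" and ff: "\<And>i. i \<in> I \<Longrightarrow> hom_bij C D F X (A i)"
    and "category C" "category D"
  shows "hom_bij C D F X P"
proof -
  note F = assms(1)
  interpret C: category C by fact
  interpret D: category D by fact
  have \<pi>: "\<And>i. i \<in> I \<Longrightarrow> \<pi> i \<in> Hom C P (A i)"
    using pr unfolding is_product_def by blast
  note F\<pi> = functor_hom[OF F \<pi>]
  have uni: "\<exists>!h. h \<in> Hom C X P \<and> (\<forall>i\<in>I. Comp C (\<pi> i) h = f i)"
    if "\<And>i. i \<in> I \<Longrightarrow> f i \<in> Hom C X (A i)" for f
    using pr X that unfolding is_product_def by blast
  have uni': "\<exists>!h. h \<in> Hom D (fobj F X) (fobj F P) \<and> (\<forall>i\<in>I. Comp D (farr F (\<pi> i)) h = f i)"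
    if "\<And>i. i \<in> I \<Longrightarrow> f i \<in> Hom D (fobj F X) (fobj F (A i))" for f
    using pr' functor_obj[OF F X] that unfolding is_product_def by blast
  show ?thesis
  proof (rule hom_bijI[OF F])
    fix f g assume fg: "f \<in> Hom C X P" "g \<in> Hom C X P" "farr F f = farr F g"
    have "Comp C (\<pi> i) f = Comp C (\<pi> i) g" if i: "i \<in> I" for i
      by (rule hom_bij_inj[OF ff[OF i]])
        (use fg \<pi>[OF i] C.comp_hom functor_comp[OF F _ \<pi>[OF i]] in auto)
    then show "f = g"
      using uni[OF C.comp_hom[OF fg(1) \<pi>]] fg(1,2) by (metis (no_types, lifting))
  next
    fix h assume h: "h \<in> Hom D (fobj F X) (fobj F P)"
    have "\<forall>i\<in>I. \<exists>f. f \<in> Hom C X (A i) \<and> farr F f = Comp D (farr F (\<pi> i)) h"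
      using hom_bij_surj[OF ff] D.comp_hom[OF h F\<pi>] by metis
    then obtain f where f: "\<And>i. i \<in> I \<Longrightarrow> f i \<in> Hom C X (A i)"
        "\<And>i. i \<in> I \<Longrightarrow> farr F (f i) = Comp D (farr F (\<pi> i)) h"
      by metis
    obtain g where g: "g \<in> Hom C X P" "\<And>i. i \<in> I \<Longrightarrow> Comp C (\<pi> i) g = f i"
      using uni[OF f(1)] by blast
    have "\<And>i. i \<in> I \<Longrightarrow> Comp D (farr F (\<pi> i)) (farr F g) = farr F (f i)"
      using g functor_comp[OF F g(1) \<pi>] by simp
    then have "farr F g = h"
      using uni'[of "\<lambda>i. farr F (f i)"] h functor_hom[OF F g(1)] functor_hom[OF F f(1)] f(2) by metis
    then show "\<exists>f\<in>Hom C X P. farr F f = h"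
      using g by blast
  qed
qed

section \<open>Additive categories\<close>

lemma Hom_group_simps [simp]:
  "carrier (Hom_group C X Y) = Hom C X Y"
  "mult (Hom_group C X Y) = Add C"
  "one (Hom_group C X Y) = Zero C X Y"
  by (simp_all add: Hom_group_def)

section \<open>Hom groups, zero morphisms and zero objects\<close>

context additive_category
begin

lemma Hom_group_group: "X \<in> Obj C \<Longrightarrow> Y \<in> Obj C \<Longrightarrow> group (Hom_group C X Y)"
  using hom_comm_group comm_group_def by blast

lemma zero_hom: "X \<in> Obj C \<Longrightarrow> Y \<in> Obj C \<Longrightarrow> Zero C X Y \<in> Hom C X Y"
  using monoid.one_closed[OF group.is_monoid[OF Hom_group_group]] by force

lemma precomp_group_hom:
  assumes "u \<in> Hom C X Y" "Z \<in> Obj C"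
  shows "group_hom (Hom_group C Y Z) (Hom_group C X Z) (\<lambda>f. Comp C f u)"
  unfolding group_hom_def group_hom_axioms_def hom_def
  using assms hom_objs[OF assms(1)] Hom_group_group comp_hom comp_add_left by auto

lemma postcomp_group_hom:
  assumes "u \<in> Hom C X Y" "Z \<in> Obj C"
  shows "group_hom (Hom_group C Z X) (Hom_group C Z Y) (\<lambda>f. Comp C u f)"
  unfolding group_hom_def group_hom_axioms_def hom_def
  using assms hom_objs[OF assms(1)] Hom_group_group comp_hom comp_add_right by auto

lemma comp_zero_left:
  assumes "u \<in> Hom C X Y" "Z \<in> Obj C"
  shows "Comp C (Zero C Y Z) u = Zero C X Z"
  using group_hom.hom_one[OF precomp_group_hom[OF assms]] by simp

lemma comp_zero_right:
  assumes "u \<in> Hom C X Y" "Z \<in> Obj C"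
  shows "Comp C u (Zero C Z X) = Zero C Z Y"
  using group_hom.hom_one[OF postcomp_group_hom[OF assms]] by simp

lemma Neg_eq: "f \<in> Hom C X Y \<Longrightarrow> Neg C f = m_inv (Hom_group C X Y) f"
  by (auto simp: Neg_def Hom_def)

lemma Neg_hom: "f \<in> Hom C X Y \<Longrightarrow> Neg C f \<in> Hom C X Y"
  using group.inv_closed[OF Hom_group_group[of X Y]] hom_objs[of f X Y] by (simp add: Neg_eq)

lemma Neg_Neg: "f \<in> Hom C X Y \<Longrightarrow> Neg C (Neg C f) = f"
  using group.inv_inv[OF Hom_group_group[of X Y]] hom_objs[of f X Y] Neg_hom[of f X Y]
  by (simp add: Neg_eq)

lemma comp_Neg_left:
  assumes "f \<in> Hom C X Y" "g \<in> Hom C Y Z"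
  shows "Comp C (Neg C g) f = Neg C (Comp C g f)"
  using group_hom.hom_inv[OF precomp_group_hom[OF assms(1)], of Z g] assms hom_objs[OF assms(2)]
    Neg_eq[OF assms(2)] Neg_eq[OF comp_hom[OF assms]] by simp

lemma comp_Neg_right:
  assumes "f \<in> Hom C X Y" "g \<in> Hom C Y Z"
  shows "Comp C g (Neg C f) = Neg C (Comp C g f)"
  using group_hom.hom_inv[OF postcomp_group_hom[OF assms(2)], of X f] assms hom_objs[OF assms(1)]
    Neg_eq[OF assms(1)] Neg_eq[OF comp_hom[OF assms]] by simp

text \<open>If the identity of \<open>Z\<close> is zero, every morphism to or from \<open>Z\<close>
  is a composite with it and vanishes. This equational form is visibly preserved by additive
  functors.\<close>

lemma zero_object_iff: "is_zero_object C Z \<longleftrightarrow> Z \<in> Obj C \<and> Ident C Z = Zero C Z Z"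
proof
  assume "is_zero_object C Z"
  then show "Z \<in> Obj C \<and> Ident C Z = Zero C Z Z"
    unfolding is_zero_object_def using ident_hom zero_hom by blast
next
  assume Z: "Z \<in> Obj C \<and> Ident C Z = Zero C Z Z"
  have "f = Zero C X Z" if "f \<in> Hom C X Z" for f X
    using comp_ident_left[OF that] comp_zero_left[OF that] Z by metis
  moreover have "f = Zero C Z X" if "f \<in> Hom C Z X" for f X
    using comp_ident_right[OF that] comp_zero_right[OF that] Z by metis
  ultimately show "is_zero_object C Z"
    unfolding is_zero_object_def using Z zero_hom[of Z] zero_hom[of _ Z] by blast
qed

lemma zero_object_hom_to: "is_zero_object C Z \<Longrightarrow> f \<in> Hom C X Z \<Longrightarrow> f = Zero C X Z"
  using zero_object_iff[of Z] comp_ident_left[of f X Z] comp_zero_left[of f X Z Z] by simp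

lemma zero_object_hom_from: "is_zero_object C Z \<Longrightarrow> g \<in> Hom C Z X \<Longrightarrow> g = Zero C Z X"
  using zero_object_iff[of Z] comp_ident_right[of g Z X] comp_zero_right[of g Z X Z] by simp

end

section \<open>Additive functors and biproducts\<close>

lemma additive_functor_group_hom:
  assumes "additive_category C" "additive_category D" "additive_functor C D F"
    and "X \<in> Obj C" "Y \<in> Obj C"
  shows "group_hom (Hom_group C X Y) (Hom_group D (fobj F X) (fobj F Y)) (farr F)"
  using assms functor_obj[of C D F] functor_hom[of C D F]
  by (auto simp: group_hom_def group_hom_axioms_def hom_def additive_functor_def
      additive_category.Hom_group_group)

lemma additive_functor_zero:
  assumes "additive_category C" "additive_category D" "additive_functor C D F"
    and "X \<in> Obj C" "Y \<in> Obj C"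
  shows "farr F (Zero C X Y) = Zero D (fobj F X) (fobj F Y)"
  using group_hom.hom_one[OF additive_functor_group_hom[OF assms]] by simp

lemma additive_functor_Neg:
  assumes "additive_category C" "additive_category D" "additive_functor C D F"
    and f: "f \<in> Hom C X Y"
  shows "farr F (Neg C f) = Neg D (farr F f)"
proof -
  interpret C: additive_category C by fact
  interpret D: additive_category D by fact
  have F: "is_functor C D F"
    using assms(3) by (simp add: additive_functor_def)
  show ?thesis
    using group_hom.hom_inv[OF additive_functor_group_hom[OF assms(1-3)], of X Y f]
      C.hom_objs[OF f] f C.Neg_eq[OF f] D.Neg_eq[OF functor_hom[OF F f]] by simp
qed

lemma additive_functor_zero_object:
  assumes "additive_category C" "additive_category D" "additive_functor C D F"
    and "is_zero_object C Z"
  shows "is_zero_object D (fobj F Z)"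
proof -
  have F: "is_functor C D F"
    using assms(3) by (simp add: additive_functor_def)
  have Z: "Z \<in> Obj C" "Ident C Z = Zero C Z Z"
    using assms(4) additive_category.zero_object_iff[OF assms(1)] by auto
  show ?thesis
    using functor_ident[OF F Z(1)] functor_obj[OF F Z(1)] additive_functor_zero[OF assms(1-3) Z(1) Z(1)]
      Z(2) additive_category.zero_object_iff[OF assms(2)] by simp
qed

text \<open>A morphism out of \<open>P\<close> is the sum of its two restrictions composed with the
  projections, and \<open>F\<close> respects this formula. Biproducts are treated apart from
  coproducts because preservation of the latter is known only for \<open>small\<close> index sets,
  which need not include one with two elements.\<close>

lemma hom_bij_biproduct_left:
  assumes "additive_category C" "additive_category D" "additive_functor C D F"
    and P: "is_biproduct C X Y P" and ff: "hom_bij C D F X Z" "hom_bij C D F Y Z"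
  shows "hom_bij C D F P Z"
proof -
  interpret C: additive_category C by fact
  interpret D: additive_category D by fact
  have F: "is_functor C D F"
    using assms(3) by (simp add: additive_functor_def)
  have Fadd: "\<And>f g X Y. f \<in> Hom C X Y \<Longrightarrow> g \<in> Hom C X Y \<Longrightarrow>
      farr F (Add C f g) = Add D (farr F f) (farr F g)"
    using assms(3) by (simp add: additive_functor_def)
  obtain i j p q where h: "i \<in> Hom C X P" "j \<in> Hom C Y P" "p \<in> Hom C P X" "q \<in> Hom C P Y"
    and id: "Add C (Comp C i p) (Comp C j q) = Ident C P" and PO: "P \<in> Obj C"
    using P unfolding is_biproduct_def by blast
  note Fh = h[THEN functor_hom[OF F]]
  have ip: "Comp C i p \<in> Hom C P P" "Comp C j q \<in> Hom C P P"
    using h C.comp_hom by blast+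
  note Fip = ip[THEN functor_hom[OF F]]
  have decomp: "f = Add C (Comp C (Comp C f i) p) (Comp C (Comp C f j) q)"
    if f: "f \<in> Hom C P Z" for f
    using C.comp_ident_right[OF f] C.comp_add_right[OF ip f] id
      C.comp_assoc[OF h(3) h(1) f] C.comp_assoc[OF h(4) h(2) f] by simp
  show ?thesis
  proof (rule hom_bijI[OF F])
    fix f g assume fg: "f \<in> Hom C P Z" "g \<in> Hom C P Z" "farr F f = farr F g"
    have "Comp C f i = Comp C g i"
      by (rule hom_bij_inj[OF ff(1)])
        (use fg h C.comp_hom in \<open>auto simp: functor_comp[OF F h(1)]\<close>)
    moreover have "Comp C f j = Comp C g j"
      by (rule hom_bij_inj[OF ff(2)])
        (use fg h C.comp_hom in \<open>auto simp: functor_comp[OF F h(2)]\<close>)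
    ultimately show "f = g"
      using decomp fg by metis
  next
    fix k assume k: "k \<in> Hom D (fobj F P) (fobj F Z)"
    obtain a where a: "a \<in> Hom C X Z" "farr F a = Comp D k (farr F i)"
      using hom_bij_surj[OF ff(1) D.comp_hom[OF Fh(1) k]] .
    obtain b where b: "b \<in> Hom C Y Z" "farr F b = Comp D k (farr F j)"
      using hom_bij_surj[OF ff(2) D.comp_hom[OF Fh(2) k]] .
    have ab: "Comp C a p \<in> Hom C P Z" "Comp C b q \<in> Hom C P Z"
      using a b h C.comp_hom by blast+
    have "farr F (Add C (Comp C a p) (Comp C b q))
        = Add D (Comp D (Comp D k (farr F i)) (farr F p)) (Comp D (Comp D k (farr F j)) (farr F q))"
      using Fadd[OF ab] functor_comp[OF F h(3) a(1)] functor_comp[OF F h(4) b(1)] a(2) b(2) by simp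
    also have "\<dots> = Comp D k (farr F (Add C (Comp C i p) (Comp C j q)))"
      using D.comp_add_right[OF Fip k] Fadd[OF ip] functor_comp[OF F h(3,1)] functor_comp[OF F h(4,2)]
        D.comp_assoc[OF Fh(3,1) k] D.comp_assoc[OF Fh(4,2) k] by simp
    also have "\<dots> = k"
      using id functor_ident[OF F PO] D.comp_ident_right[OF k] by simp
    finally show "\<exists>f\<in>Hom C P Z. farr F f = k"
      using group.is_monoid[OF C.Hom_group_group[of P Z], THEN monoid.m_closed] ab C.hom_objs[OF ab(1)]
      by force
  qed
qed

lemma hom_bij_biproduct_right:
  assumes "additive_category C" "additive_category D" "additive_functor C D F"
    and P: "is_biproduct C X Y P" and ff: "hom_bij C D F Z X" "hom_bij C D F Z Y"
  shows "hom_bij C D F Z P"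
proof -
  interpret C: additive_category C by fact
  interpret D: additive_category D by fact
  have F: "is_functor C D F"
    using assms(3) by (simp add: additive_functor_def)
  have Fadd: "\<And>f g X Y. f \<in> Hom C X Y \<Longrightarrow> g \<in> Hom C X Y \<Longrightarrow>
      farr F (Add C f g) = Add D (farr F f) (farr F g)"
    using assms(3) by (simp add: additive_functor_def)
  obtain i j p q where h: "i \<in> Hom C X P" "j \<in> Hom C Y P" "p \<in> Hom C P X" "q \<in> Hom C P Y"
    and id: "Add C (Comp C i p) (Comp C j q) = Ident C P" and PO: "P \<in> Obj C"
    using P unfolding is_biproduct_def by blast
  note Fh = h[THEN functor_hom[OF F]]
  have ip: "Comp C i p \<in> Hom C P P" "Comp C j q \<in> Hom C P P"
    using h C.comp_hom by blast+
  note Fip = ip[THEN functor_hom[OF F]]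
  have decomp: "f = Add C (Comp C i (Comp C p f)) (Comp C j (Comp C q f))"
    if f: "f \<in> Hom C Z P" for f
    using C.comp_ident_left[OF f] C.comp_add_left[OF f ip] id
      C.comp_assoc[OF f h(3,1)] C.comp_assoc[OF f h(4,2)] by simp
  show ?thesis
  proof (rule hom_bijI[OF F])
    fix f g assume fg: "f \<in> Hom C Z P" "g \<in> Hom C Z P" "farr F f = farr F g"
    have "Comp C p f = Comp C p g"
      by (rule hom_bij_inj[OF ff(1)])
        (use fg h C.comp_hom in \<open>auto simp: functor_comp[OF F _ h(3)]\<close>)
    moreover have "Comp C q f = Comp C q g"
      by (rule hom_bij_inj[OF ff(2)])
        (use fg h C.comp_hom in \<open>auto simp: functor_comp[OF F _ h(4)]\<close>)
    ultimately show "f = g"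
      using decomp fg by metis
  next
    fix k assume k: "k \<in> Hom D (fobj F Z) (fobj F P)"
    obtain a where a: "a \<in> Hom C Z X" "farr F a = Comp D (farr F p) k"
      using hom_bij_surj[OF ff(1) D.comp_hom[OF k Fh(3)]] .
    obtain b where b: "b \<in> Hom C Z Y" "farr F b = Comp D (farr F q) k"
      using hom_bij_surj[OF ff(2) D.comp_hom[OF k Fh(4)]] .
    have ab: "Comp C i a \<in> Hom C Z P" "Comp C j b \<in> Hom C Z P"
      using a b h C.comp_hom by blast+
    have "farr F (Add C (Comp C i a) (Comp C j b))
        = Add D (Comp D (farr F i) (Comp D (farr F p) k)) (Comp D (farr F j) (Comp D (farr F q) k))"
      using Fadd[OF ab] functor_comp[OF F a(1) h(1)] functor_comp[OF F b(1) h(2)] a(2) b(2) by simp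
    also have "\<dots> = Comp D (farr F (Add C (Comp C i p) (Comp C j q))) k"
      using D.comp_add_left[OF k Fip] Fadd[OF ip] functor_comp[OF F h(3,1)] functor_comp[OF F h(4,2)]
        D.comp_assoc[OF k Fh(3,1)] D.comp_assoc[OF k Fh(4,2)] by simp
    also have "\<dots> = k"
      using id functor_ident[OF F PO] D.comp_ident_left[OF k] by simp
    finally show "\<exists>f\<in>Hom C Z P. farr F f = k"
      using group.is_monoid[OF C.Hom_group_group[of Z P], THEN monoid.m_closed] ab C.hom_objs[OF ab(1)]
      by force
  qed
qed

section \<open>Triangulated categories\<close>

lemma exact_triangle_homs:
  assumes "exact_triangle T X Y Z u v w"
  shows "u \<in> Hom T X Y" "v \<in> Hom T Y Z" "w \<in> Hom T Z (SuspO T X)"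
  using assms by (auto simp: exact_triangle_def triangle_def)

context triangulated_category
begin

section \<open>Suspension and desuspension\<close>

lemma susp_functor: "is_functor T T (Susp T)"
  using susp_additive by (simp add: additive_functor_def)

lemma susp_obj: "X \<in> Obj T \<Longrightarrow> SuspO T X \<in> Obj T"
  by (rule functor_obj[OF susp_functor])

lemma susp_hom: "f \<in> Hom T X Y \<Longrightarrow> SuspM T f \<in> Hom T (SuspO T X) (SuspO T Y)"
  by (rule functor_hom[OF susp_functor])

lemma susp_hom_bij: "X \<in> Obj T \<Longrightarrow> Y \<in> Obj T \<Longrightarrow> hom_bij T T (Susp T) X Y"
  by (rule equivalence_hom_bij[OF category_axioms category_axioms susp_equivalence])

lemma ex_desuspension: "Y \<in> Obj T \<Longrightarrow> \<exists>X\<in>Obj T. isomorphic T (SuspO T X) Y"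
  by (rule equivalence_essentially_surjective[OF susp_equivalence])

lemma susp_Neg: "f \<in> Hom T X Y \<Longrightarrow> SuspM T (Neg T f) = Neg T (SuspM T f)"
  by (rule additive_functor_Neg[OF additive_category_axioms additive_category_axioms susp_additive])

section \<open>Long exact Hom sequences of exact triangles\<close>

lemma exact_triangle_rotate:
  "exact_triangle T X Y Z u v w \<Longrightarrow> exact_triangle T Y Z (SuspO T X) v w (Neg T (SuspM T u))"
  using TR2 unfolding exact_triangle_def by blast

lemma exact_triangle_comp_zero:
  assumes t: "exact_triangle T X Y Z u v w"
  shows "Comp T v u = Zero T X Z"
proof -
  note h = exact_triangle_homs[OF t]
  obtain N where N: "is_zero_object T N"
    using ex_zero_object by blast
  have X: "X \<in> Obj T"
    using hom_objs[OF h(1)] by blast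
  \<comment> \<open>The identity of \<open>X\<close> and \<open>u\<close> map the triangle on that
    identity to the given one, so \<open>v\<close> after \<open>u\<close> factors through the zero
    object \<open>N\<close>.\<close>
  obtain c where c: "c \<in> Hom T N Z" "Comp T c (Zero T X N) = Comp T v u"
    using TR3[OF TR1_ident[OF X N] t ident_hom[OF X] h(1)] by auto
  then show ?thesis
    using comp_zero_right[OF c(1) X] by simp
qed

text \<open>Zero and \<open>f\<close> form a map to the triangle with vertices zero,
  \<open>D\<close>, \<open>D\<close>; the third component supplied by \<open>TR3\<close> is the
  factorization.\<close>

lemma exact_triangle_weak_cokernel:
  assumes t: "exact_triangle T X Y Z u v w" and f: "f \<in> Hom T Y D" "Comp T f u = Zero T X D"
  shows "\<exists>g\<in>Hom T Z D. f = Comp T g v"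
proof -
  note h = exact_triangle_homs[OF t]
  have X: "X \<in> Obj T" and D: "D \<in> Obj T"
    using hom_objs[OF h(1)] hom_objs[OF f(1)] by auto
  obtain N where N: "is_zero_object T N"
    using ex_zero_object by blast
  then have NO: "N \<in> Obj T"
    by (simp add: is_zero_object_def)
  have SN: "is_zero_object T (SuspO T N)"
    by (rule additive_functor_zero_object[OF additive_category_axioms additive_category_axioms
        susp_additive N])
  \<comment> \<open>The triangle on the identity of \<open>D\<close>, with \<open>SuspO T N\<close>
    as zero object and the last morphism rewritten as a negated suspension: in this form
    \<open>TR2\<close> can be read backwards, moving \<open>N\<close> to the front.\<close>
  have "exact_triangle T D D (SuspO T N) (Ident T D) (Zero T D (SuspO T N))
      (Neg T (SuspM T (Zero T N D)))"
    using TR1_ident[OF D SN] zero_object_hom_from[OF SN Neg_hom[OF susp_hom[OF zero_hom[OF NO D]]]]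
    by simp
  then have "exact_triangle T N D D (Zero T N D) (Ident T D) (Zero T D (SuspO T N))"
    using TR2[of N D D "Zero T N D" "Ident T D" "Zero T D (SuspO T N)"] zero_hom ident_hom NO D
      susp_obj by (simp add: triangle_def)
  from TR3[OF t this zero_hom[OF X NO] f(1)] obtain c where
    "c \<in> Hom T Z D" "Comp T c v = Comp T (Ident T D) f"
    using f(2) comp_zero_left[OF zero_hom[OF X NO] D] by auto
  then show ?thesis
    using comp_ident_left[OF f(1)] by auto
qed

text \<open>\<open>TR3\<close> produces third components only, so both triangles are rotated until
  \<open>D\<close> and \<open>X\<close> appear suspended in third place. The resulting morphism
  desuspends since \<Sigma> is fully faithful, and the signs of the two rotations cancel.\<close>

lemma exact_triangle_weak_kernel:
  assumes t: "exact_triangle T X Y Z u v w" and f: "f \<in> Hom T D Y" "Comp T v f = Zero T D Z"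
  shows "\<exists>g\<in>Hom T D X. f = Comp T u g"
proof -
  note h = exact_triangle_homs[OF t]
  have X: "X \<in> Obj T" and D: "D \<in> Obj T" and Z: "Z \<in> Obj T"
    using hom_objs[OF h(1)] hom_objs[OF f(1)] hom_objs[OF h(2)] by auto
  obtain N where N: "is_zero_object T N"
    using ex_zero_object by blast
  then have NO: "N \<in> Obj T"
    by (simp add: is_zero_object_def)
  have "exact_triangle T D N (SuspO T D) (Zero T D N) (Zero T N (SuspO T D))
      (Neg T (SuspM T (Ident T D)))"
    by (rule exact_triangle_rotate[OF TR1_ident[OF D N]])
  from TR3[OF this exact_triangle_rotate[OF t] f(1) zero_hom[OF NO Z]] obtain c where
    c: "c \<in> Hom T (SuspO T D) (SuspO T X)"
      "Comp T (SuspM T f) (Neg T (SuspM T (Ident T D))) = Comp T (Neg T (SuspM T u)) c"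
    using f(2) comp_zero_right[OF zero_hom[OF NO Z] D] comp_zero_left[OF zero_hom[OF D NO] Z] by auto
  obtain g where g: "g \<in> Hom T D X" "SuspM T g = c"
    using hom_bij_surj[OF susp_hom_bij[OF D X] c(1)] .
  note Sf = susp_hom[OF f(1)] and Su = susp_hom[OF h(1)] and Sid = susp_hom[OF ident_hom[OF D]]
  have "Comp T (SuspM T f) (Neg T (SuspM T (Ident T D))) = Neg T (SuspM T f)"
    using comp_Neg_right[OF Sid Sf] functor_comp[OF susp_functor ident_hom[OF D] f(1)]
      comp_ident_right[OF f(1)] by simp
  moreover have "Comp T (Neg T (SuspM T u)) c = Neg T (SuspM T (Comp T u g))"
    using comp_Neg_left[OF c(1) Su] functor_comp[OF susp_functor g(1) h(1)] g(2) by simp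
  ultimately have "SuspM T f = SuspM T (Comp T u g)"
    using c(2) Neg_Neg[OF Sf] Neg_Neg[OF susp_hom[OF comp_hom[OF g(1) h(1)]]] by metis
  then have "f = Comp T u g"
    using hom_bij_inj[OF susp_hom_bij f(1) comp_hom[OF g(1) h(1)]] hom_objs[OF f(1)] by blast
  then show ?thesis
    using g(1) by blast
qed

text \<open>The composite of \<open>u\<close> and \<open>v\<close> vanishes and \<open>v\<close> is
  a weak cokernel: together this is exactness at \<open>Hom T Y D\<close>, in the form
  \<open>five_lemma\<close> consumes.\<close>

lemma exact_triangle_precomp_exact:
  assumes t: "exact_triangle T X Y Z u v w" and f: "f \<in> Hom T Y D"
  shows "Comp T f u = Zero T X D \<longleftrightarrow> f \<in> (\<lambda>g. Comp T g v) ` Hom T Z D"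
proof
  assume "Comp T f u = Zero T X D"
  then show "f \<in> (\<lambda>g. Comp T g v) ` Hom T Z D"
    using exact_triangle_weak_cokernel[OF t f] by blast
next
  note h = exact_triangle_homs[OF t]
  assume "f \<in> (\<lambda>g. Comp T g v) ` Hom T Z D"
  then obtain g where g: "g \<in> Hom T Z D" "f = Comp T g v"
    by blast
  then show "Comp T f u = Zero T X D"
    using comp_assoc[OF h(1,2) g(1)] exact_triangle_comp_zero[OF t] comp_zero_right[OF g(1)]
      hom_objs[OF h(1)] by simp
qed

lemma exact_triangle_postcomp_exact:
  assumes t: "exact_triangle T X Y Z u v w" and f: "f \<in> Hom T D Y"
  shows "Comp T v f = Zero T D Z \<longleftrightarrow> f \<in> (\<lambda>g. Comp T u g) ` Hom T D X"
proof
  assume "Comp T v f = Zero T D Z"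
  then show "f \<in> (\<lambda>g. Comp T u g) ` Hom T D X"
    using exact_triangle_weak_kernel[OF t f] by blast
next
  note h = exact_triangle_homs[OF t]
  assume "f \<in> (\<lambda>g. Comp T u g) ` Hom T D X"
  then obtain g where g: "g \<in> Hom T D X" "f = Comp T u g"
    by blast
  then show "Comp T v f = Zero T D Z"
    using comp_assoc[OF g(1) h(1,2)] exact_triangle_comp_zero[OF t] comp_zero_left[OF g(1)]
      hom_objs[OF h(2)] by simp
qed

text \<open>\<Sigma> is only an auto-equivalence, so \<open>Z\<close> is a suspension merely up to
  isomorphism. It is first replaced by \<open>SuspO T W\<close> through \<open>TR1_iso\<close>,
  after which \<open>TR2\<close> applies backwards.\<close>

lemma exact_triangle_rotate_back:
  assumes t: "exact_triangle T X Y Z u v w" and W: "W \<in> Obj T" and iso: "isomorphic T (SuspO T W) Z"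
  shows "\<exists>t' v'. exact_triangle T W X Y t' u v'"
proof -
  note h = exact_triangle_homs[OF t]
  have X: "X \<in> Obj T" and Y: "Y \<in> Obj T"
    using hom_objs[OF h(1)] by auto
  obtain c d where c: "c \<in> Hom T (SuspO T W) Z" and d: "d \<in> Hom T Z (SuspO T W)"
    and dc: "Comp T d c = Ident T (SuspO T W)" and cd: "Comp T c d = Ident T Z"
    using iso unfolding isomorphic_def is_iso_def by blast
  have di: "is_iso T Z (SuspO T W) d"
    unfolding is_iso_def using c d cd dc by blast
  have wc: "Comp T w c \<in> Hom T (SuspO T W) (SuspO T X)"
    by (rule comp_hom[OF c h(3)])
  obtain s where s: "s \<in> Hom T W X" "SuspM T s = Comp T w c"
    using hom_bij_surj[OF susp_hom_bij[OF W X] wc] .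
  \<comment> \<open>The sign cancels the one that \<open>TR2\<close> puts on the suspended
    morphism.\<close>
  define t' where "t' = Neg T s"
  have t': "t' \<in> Hom T W X" "Neg T (SuspM T t') = Comp T w c"
    using Neg_hom[OF s(1)] susp_Neg[OF s(1)] s(2) Neg_Neg[OF wc] by (simp_all add: t'_def)
  have dv: "Comp T d v \<in> Hom T Y (SuspO T W)"
    by (rule comp_hom[OF h(2) d])
  have "exact_triangle T X Y (SuspO T W) u (Comp T d v) (Comp T w c)"
  proof (rule TR1_iso[OF t _ is_iso_ident[OF X] is_iso_ident[OF Y] di])
    show "triangle T X Y (SuspO T W) u (Comp T d v) (Comp T w c)"
      using h dv wc by (simp add: triangle_def)
    show "Comp T (Ident T Y) u = Comp T u (Ident T X)"
      using comp_ident_left[OF h(1)] comp_ident_right[OF h(1)] by simp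
    show "Comp T d v = Comp T (Comp T d v) (Ident T Y)"
      using comp_ident_right[OF dv] by simp
    show "Comp T (SuspM T (Ident T X)) w = Comp T (Comp T w c) d"
      using functor_ident[OF susp_functor X] comp_ident_left[OF h(3)] comp_assoc[OF d c h(3)] cd
        comp_ident_right[OF h(3)] by simp
  qed
  then have "exact_triangle T W X Y t' u (Comp T d v)"
    using TR2[of W X Y t' u "Comp T d v"] t' h(1) dv by (simp add: triangle_def)
  then show ?thesis
    by blast
qed

end

section \<open>Triangle functors\<close>

locale triangle_functor_pair =
  T: triangulated_category T + T': triangulated_category T'
  for T :: "('o, 'm, 'a) tri_cat_scheme" and T' :: "('p, 'n, 'b) tri_cat_scheme" +
  fixes F :: "('o, 'm, 'p, 'n) functor_data" and \<omega> :: "'o \<Rightarrow> 'n"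
  assumes F: "triangle_functor T T' F \<omega>"
begin

lemma F_additive: "additive_functor T T' F"
  using F by (simp add: triangle_functor_def)

lemma F_functor: "is_functor T T' F"
  using F_additive by (simp add: additive_functor_def)

lemma F_exact: "exact_triangle T X Y Z u v w \<Longrightarrow>
  exact_triangle T' (fobj F X) (fobj F Y) (fobj F Z) (farr F u) (farr F v) (Comp T' (\<omega> X) (farr F w))"
  using F by (simp add: triangle_functor_def)

abbreviation ff :: "'o \<Rightarrow> 'o \<Rightarrow> bool" where
  "ff \<equiv> hom_bij T T' F"

lemma F_group_hom: "X \<in> Obj T \<Longrightarrow> Y \<in> Obj T \<Longrightarrow>
  group_hom (Hom_group T X Y) (Hom_group T' (fobj F X) (fobj F Y)) (farr F)"
  by (rule additive_functor_group_hom[OF T.additive_category_axioms T'.additive_category_axioms F_additive])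

lemma ff_iso_left: "isomorphic T X X' \<Longrightarrow> ff X Y \<Longrightarrow> ff X' Y"
  by (rule hom_bij_iso_left[OF T.category_axioms T'.category_axioms F_functor])

lemma ff_iso_right: "isomorphic T Y Y' \<Longrightarrow> ff X Y \<Longrightarrow> ff X Y'"
  by (rule hom_bij_iso_right[OF T.category_axioms T'.category_axioms F_functor])

text \<open>Naturality of \<omega> identifies \<open>farr F\<close> after \<open>SuspM T\<close>
  with \<open>SuspM T'\<close> after \<open>farr F\<close>, up to composition with isomorphisms.
  Suspensions and these compositions are bijective on Hom sets, so either occurrence of
  \<open>farr F\<close> is bijective exactly when the other is.\<close>

lemma ff_susp_iff:
  assumes X: "X \<in> Obj T" and Y: "Y \<in> Obj T"
  shows "ff (SuspO T X) (SuspO T Y) \<longleftrightarrow> ff X Y"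
proof -
  let ?A = "Hom T X Y" and ?P = "Hom T' (fobj F (SuspO T X)) (fobj F (SuspO T Y))"
  let ?Q = "Hom T' (fobj F (SuspO T X)) (SuspO T' (fobj F Y))"
  let ?R = "Hom T' (SuspO T' (fobj F X)) (SuspO T' (fobj F Y))"
  let ?S = "Hom T' (fobj F X) (fobj F Y)"
  have \<omega>: "natural_iso T T' (comp_functor F (Susp T)) (comp_functor (Susp T') F) \<omega>"
    using F by (simp add: triangle_functor_def)
  have \<omega>X: "is_iso T' (fobj F (SuspO T X)) (SuspO T' (fobj F X)) (\<omega> X)"
    and \<omega>Y: "is_iso T' (fobj F (SuspO T Y)) (SuspO T' (fobj F Y)) (\<omega> Y)"
    using \<omega> X Y by (auto simp: natural_iso_def comp_functor_def)
  have nat: "Comp T' (\<omega> Y) (farr F (SuspM T f)) = Comp T' (SuspM T' (farr F f)) (\<omega> X)"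
    if "f \<in> ?A" for f
    using \<omega> that by (simp add: natural_iso_def comp_functor_def)
  have \<alpha>: "bij_betw (Comp T' (\<omega> Y)) ?P ?Q"
    using T'.bij_betw_postcomp[OF \<omega>Y] by simp
  have \<beta>: "bij_betw (\<lambda>f. Comp T' f (\<omega> X)) ?R ?Q"
    by (rule T'.bij_betw_precomp[OF \<omega>X])
  have \<sigma>: "bij_betw (SuspM T) ?A (Hom T (SuspO T X) (SuspO T Y))"
    using T.susp_hom_bij[OF X Y] by (simp add: hom_bij_def)
  have \<sigma>': "bij_betw (SuspM T') ?S ?R"
    using T'.susp_hom_bij functor_obj[OF F_functor] X Y by (simp add: hom_bij_def)
  have "ff (SuspO T X) (SuspO T Y) \<longleftrightarrow> bij_betw (farr F \<circ> SuspM T) ?A ?P"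
    unfolding hom_bij_def by (rule bij_betw_comp_iff[OF \<sigma>])
  also have "\<dots> \<longleftrightarrow> bij_betw (Comp T' (\<omega> Y) \<circ> (farr F \<circ> SuspM T)) ?A ?Q"
    by (rule bij_betw_comp_iff2[OF \<alpha>]) (use T.susp_hom functor_hom[OF F_functor] in auto)
  also have "\<dots> \<longleftrightarrow> bij_betw ((\<lambda>f. Comp T' f (\<omega> X)) \<circ> (SuspM T' \<circ> farr F)) ?A ?Q"
    by (rule bij_betw_cong) (simp add: nat)
  also have "\<dots> \<longleftrightarrow> bij_betw (SuspM T' \<circ> farr F) ?A ?R"
    by (rule bij_betw_comp_iff2[OF \<beta>, symmetric])
      (use T'.susp_hom functor_hom[OF F_functor] in auto)
  also have "\<dots> \<longleftrightarrow> ff X Y"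
    unfolding hom_bij_def
    by (rule bij_betw_comp_iff2[OF \<sigma>', symmetric]) (use functor_hom[OF F_functor] in auto)
  finally show ?thesis .
qed

text \<open>The five lemma for the contravariant Hom sequence into \<open>D\<close>, running from
  \<open>SuspO T Y\<close> through \<open>Z\<close> to \<open>X\<close>.\<close>

lemma ff_cone_left:
  assumes t: "exact_triangle T X Y Z u v w" and D: "D \<in> Obj T"
    and "ff X D" "ff Y D" "ff (SuspO T X) D" "ff (SuspO T Y) D"
  shows "ff Z D"
proof -
  note t2 = T.exact_triangle_rotate[OF t]
  note t3 = T.exact_triangle_rotate[OF t2]
  note h = exact_triangle_homs[OF t] exact_triangle_homs(3)[OF t2]
  have O: "X \<in> Obj T" "Y \<in> Obj T" "Z \<in> Obj T" "SuspO T X \<in> Obj T" "SuspO T Y \<in> Obj T"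
    using T.hom_objs[OF h(1)] T.hom_objs[OF h(2)] T.susp_obj by auto
  note Fh = h[THEN functor_hom[OF F_functor]]
  note FD = functor_obj[OF F_functor D]
  \<comment> \<open>The exact rows in \<open>T'\<close> come from the images of the three rotations
    formed in \<open>T\<close>, not from rotating the image triangle: exactness involves only the
    first two morphisms, and \<omega> occurs only in the third.\<close>
  note ex = T.exact_triangle_precomp_exact and ex' = T'.exact_triangle_precomp_exact
  show ?thesis
    unfolding hom_bij_def
    using five_lemma[OF T.precomp_group_hom[OF h(4) D] T.precomp_group_hom[OF h(3) D]
      T.precomp_group_hom[OF h(2) D] T.precomp_group_hom[OF h(1) D]
      T'.precomp_group_hom[OF Fh(4) FD] T'.precomp_group_hom[OF Fh(3) FD]
      T'.precomp_group_hom[OF Fh(2) FD] T'.precomp_group_hom[OF Fh(1) FD]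
      _ _ _ _ _ _
      F_group_hom[OF O(4) D] F_group_hom[OF O(3) D] F_group_hom[OF O(2) D] F_group_hom[OF O(1) D],
      of "farr F"]
      ex[OF t] ex[OF t2] ex[OF t3] ex'[OF F_exact[OF t]] ex'[OF F_exact[OF t2]]
      ex'[OF F_exact[OF t3]] assms(3-) functor_comp[OF F_functor h(1)] functor_comp[OF F_functor h(2)]
      functor_comp[OF F_functor h(3)] functor_comp[OF F_functor h(4)]
    by (simp add: hom_bij_def bij_betw_imp_surj_on bij_betw_imp_inj_on)
qed

text \<open>The covariant counterpart, with the sequence running from \<open>X\<close> through
  \<open>Z\<close> to \<open>SuspO T Y\<close>.\<close>

lemma ff_cone_right:
  assumes t: "exact_triangle T X Y Z u v w" and D: "D \<in> Obj T"
    and "ff D X" "ff D Y" "ff D (SuspO T X)" "ff D (SuspO T Y)"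
  shows "ff D Z"
proof -
  note t2 = T.exact_triangle_rotate[OF t]
  note t3 = T.exact_triangle_rotate[OF t2]
  note h = exact_triangle_homs[OF t] exact_triangle_homs(3)[OF t2]
  have O: "X \<in> Obj T" "Y \<in> Obj T" "Z \<in> Obj T" "SuspO T X \<in> Obj T" "SuspO T Y \<in> Obj T"
    using T.hom_objs[OF h(1)] T.hom_objs[OF h(2)] T.susp_obj by auto
  note Fh = h[THEN functor_hom[OF F_functor]]
  note FD = functor_obj[OF F_functor D]
  note ex = T.exact_triangle_postcomp_exact and ex' = T'.exact_triangle_postcomp_exact
  show ?thesis
    unfolding hom_bij_def
    using five_lemma[OF T.postcomp_group_hom[OF h(1) D] T.postcomp_group_hom[OF h(2) D]
      T.postcomp_group_hom[OF h(3) D] T.postcomp_group_hom[OF h(4) D]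
      T'.postcomp_group_hom[OF Fh(1) FD] T'.postcomp_group_hom[OF Fh(2) FD]
      T'.postcomp_group_hom[OF Fh(3) FD] T'.postcomp_group_hom[OF Fh(4) FD]
      _ _ _ _ _ _
      F_group_hom[OF D O(2)] F_group_hom[OF D O(3)] F_group_hom[OF D O(4)] F_group_hom[OF D O(5)],
      of "farr F"]
      ex[OF t] ex[OF t2] ex[OF t3] ex'[OF F_exact[OF t]] ex'[OF F_exact[OF t2]]
      ex'[OF F_exact[OF t3]] assms(3-) functor_comp[OF F_functor _ h(1)] functor_comp[OF F_functor _ h(2)]
      functor_comp[OF F_functor _ h(3)] functor_comp[OF F_functor _ h(4)]
    by (simp add: hom_bij_def bij_betw_imp_surj_on bij_betw_imp_inj_on)
qed

end

section \<open>Powers of the suspension\<close>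

context triangulated_category
begin

lemma isomorphic_susp_iff:
  assumes X: "X \<in> Obj T" and Y: "Y \<in> Obj T"
  shows "isomorphic T (SuspO T X) (SuspO T Y) \<longleftrightarrow> isomorphic T X Y"
proof
  assume "isomorphic T X Y"
  then show "isomorphic T (SuspO T X) (SuspO T Y)"
    by (rule functor_isomorphic[OF susp_functor])
next
  note lift = hom_bij_surj[OF susp_hom_bij] and inj = hom_bij_inj[OF susp_hom_bij]
  assume "isomorphic T (SuspO T X) (SuspO T Y)"
  then obtain c d where c: "c \<in> Hom T (SuspO T X) (SuspO T Y)" and d: "d \<in> Hom T (SuspO T Y) (SuspO T X)"
    and dc: "Comp T d c = Ident T (SuspO T X)" and cd: "Comp T c d = Ident T (SuspO T Y)"
    unfolding isomorphic_def is_iso_def by blast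
  obtain f where f: "f \<in> Hom T X Y" "SuspM T f = c"
    using lift[OF X Y c] .
  obtain g where g: "g \<in> Hom T Y X" "SuspM T g = d"
    using lift[OF Y X d] .
  have "Comp T g f = Ident T X"
    by (rule inj[OF X X comp_hom[OF f(1) g(1)] ident_hom[OF X]])
      (simp add: functor_comp[OF susp_functor f(1) g(1)] functor_ident[OF susp_functor X] f g dc)
  moreover have "Comp T f g = Ident T Y"
    by (rule inj[OF Y Y comp_hom[OF g(1) f(1)] ident_hom[OF Y]])
      (simp add: functor_comp[OF susp_functor g(1) f(1)] functor_ident[OF susp_functor Y] f g cd)
  ultimately show "isomorphic T X Y"
    unfolding isomorphic_def is_iso_def using f g by blast
qed

lemma susp_funpow_obj: "X \<in> Obj T \<Longrightarrow> (SuspO T ^^ k) X \<in> Obj T"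
  by (induction k) (simp_all add: susp_obj)

lemma susp_funpow_isomorphic:
  "isomorphic T X Y \<Longrightarrow> isomorphic T ((SuspO T ^^ k) X) ((SuspO T ^^ k) Y)"
  by (induction k) (simp_all add: functor_isomorphic[OF susp_functor])

lemma susp_pow_subset: "susp_pow T n A \<subseteq> Obj T"
  by (auto simp: susp_pow_def)

lemma susp_pow_isomorphic:
  assumes "X \<in> susp_pow T n A" "isomorphic T X Y"
  shows "Y \<in> susp_pow T n A"
proof -
  have "Y \<in> Obj T"
    using assms isomorphic_objs by blast
  then show ?thesis
    using assms isomorphic_trans susp_funpow_isomorphic
    unfolding susp_pow_def by (auto split: if_splits) blast+
qed

lemma subset_susp_pow_0: "A \<subseteq> Obj T \<Longrightarrow> A \<subseteq> susp_pow T 0 A"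
  using isomorphic_refl by (auto simp: susp_pow_def)

text \<open>One suspension step for every integer exponent; it hides the case split in
  \<open>susp_pow\<close> from the inductions that follow.\<close>

lemma susp_pow_susp_iff:
  assumes A: "A \<subseteq> Obj T" and X: "X \<in> Obj T"
  shows "SuspO T X \<in> susp_pow T (n + 1) A \<longleftrightarrow> X \<in> susp_pow T n A"
proof (cases "0 \<le> n")
  case True
  have "isomorphic T (SuspO T ((SuspO T ^^ nat n) Z)) (SuspO T X) \<longleftrightarrow>
      isomorphic T ((SuspO T ^^ nat n) Z) X" if "Z \<in> A" for Z
    using isomorphic_susp_iff susp_funpow_obj that A X by blast
  then show ?thesis
    using True X susp_obj[OF X] by (simp add: susp_pow_def nat_add_distrib)
next
  case False
  define k where "k = nat (- n - 1)"
  have n: "n = - int (Suc k)"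
    using False by (simp add: k_def)
  show ?thesis
  proof (cases k)
    \<comment> \<open>The boundary \<open>n = -1\<close>: the two sides fall into different branches
      of \<open>susp_pow\<close>, which here unfold to the same condition.\<close>
    case 0
    then show ?thesis
      using n X susp_obj[OF X] by (simp add: susp_pow_def)
  next
    case (Suc j)
    then have "nat (- n) = Suc (nat (- (n + 1)))" "\<not> 0 \<le> n + 1" "\<not> 0 \<le> n"
      using n by simp_all
    then show ?thesis
      using X susp_obj[OF X] by (simp add: susp_pow_def funpow_swap1)
  qed
qed

text \<open>From exponent 0 the one-step inclusion spreads in both directions: upwards by passing to
  a desuspension, downwards by suspending. The case of interest is the nesting of the levels of
  \<open>V\<close>.\<close>

lemma susp_pow_antimono:
  assumes A: "A \<subseteq> Obj T" "susp_pow T 1 A \<subseteq> A" and "m \<le> n"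
  shows "susp_pow T n A \<subseteq> susp_pow T m A"
proof -
  have step: "susp_pow T (k + 1) A \<subseteq> susp_pow T k A" for k
  proof (induction k rule: int_induct[where k = 0])
    case base
    show ?case
      using A subset_susp_pow_0[OF A(1)] by simp
  next
    case (step1 k)
    show ?case
    proof
      fix X assume X: "X \<in> susp_pow T (k + 1 + 1) A"
      then obtain X' where X': "X' \<in> Obj T" "isomorphic T (SuspO T X') X"
        using ex_desuspension susp_pow_subset by blast
      then have "SuspO T X' \<in> susp_pow T (k + 1 + 1) A"
        using X isomorphic_sym susp_pow_isomorphic by blast
      then have "X' \<in> susp_pow T k A"
        using susp_pow_susp_iff[OF A(1) X'(1)] step1 by blast
      then show "X \<in> susp_pow T (k + 1) A"
        using susp_pow_susp_iff[OF A(1) X'(1)] X'(2) susp_pow_isomorphic by blast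
    qed
  next
    case (step2 k)
    show ?case
    proof
      fix X assume X: "X \<in> susp_pow T (k - 1 + 1) A"
      then have XO: "X \<in> Obj T"
        using susp_pow_subset by blast
      have "SuspO T X \<in> susp_pow T k A"
        using susp_pow_susp_iff[OF A(1) XO, of k] X step2 by auto
      then show "X \<in> susp_pow T (k - 1) A"
        using susp_pow_susp_iff[OF A(1) XO, of "k - 1"] by simp
    qed
  qed
  show ?thesis
    using assms(3) by (induction n rule: int_ge_induct) (use step in blast)+
qed

text \<open>The classes against which goodness is tested. Stability under the inverse of \<Sigma> is
  expressed by the equivalence, so that no quasi-inverse has to be chosen.\<close>

definition shift_stable :: "'o set \<Rightarrow> bool" where
  "shift_stable W \<longleftrightarrow> W \<subseteq> Obj T \<and> (\<forall>X\<in>W. \<forall>Y. isomorphic T X Y \<longrightarrow> Y \<in> W) \<and>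
     (\<forall>X\<in>Obj T. SuspO T X \<in> W \<longleftrightarrow> X \<in> W)"

lemma shift_stable_desuspension:
  assumes "shift_stable W" "X \<in> W"
  obtains X' where "X' \<in> W" "isomorphic T (SuspO T X') X"
  using assms ex_desuspension isomorphic_sym unfolding shift_stable_def by (metis subsetD)

lemma shift_stable_susp_pow:
  assumes "shift_stable W"
  shows "susp_pow T 1 W \<subseteq> W" "susp_pow T (-1) W \<subseteq> W"
proof -
  have W: "\<And>X. X \<in> W \<Longrightarrow> X \<in> Obj T" "\<And>X Y. X \<in> W \<Longrightarrow> isomorphic T X Y \<Longrightarrow> Y \<in> W"
    "\<And>X. X \<in> Obj T \<Longrightarrow> SuspO T X \<in> W \<longleftrightarrow> X \<in> W"
    using assms unfolding shift_stable_def by auto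
  show "susp_pow T 1 W \<subseteq> W"
  proof
    fix Y assume "Y \<in> susp_pow T 1 W"
    then obtain X where "X \<in> W" "isomorphic T (SuspO T X) Y"
      by (auto simp: susp_pow_def)
    then show "Y \<in> W"
      using W by metis
  qed
  show "susp_pow T (-1) W \<subseteq> W"
  proof
    fix Y assume "Y \<in> susp_pow T (-1) W"
    then obtain X where "X \<in> W" "isomorphic T X (SuspO T Y)" "Y \<in> Obj T"
      by (auto simp: susp_pow_def)
    then show "Y \<in> W"
      using W by metis
  qed
qed

lemma shift_stable_Obj: "shift_stable (Obj T)"
  unfolding shift_stable_def using isomorphic_objs susp_obj by blast

lemma level_susp_iff:
  assumes "A \<subseteq> Obj T" "X \<in> Obj T"
  shows "SuspO T X \<in> level T A m \<longleftrightarrow> X \<in> level T A (m + 1)"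
  using susp_pow_susp_iff[OF assms, of "- (m + 1)"] by (simp add: level_def)

text \<open>Applied to \<open>U\<close>, which is assumed closed under desuspension only, this gives
  a stable class whose objects all lie in some level.\<close>

lemma shift_stable_levels:
  assumes "A \<subseteq> Obj T"
  shows "shift_stable (\<Union>m. level T A m)"
proof -
  have "SuspO T X \<in> (\<Union>m. level T A m) \<longleftrightarrow> X \<in> (\<Union>m. level T A m)" if "X \<in> Obj T" for X
    using level_susp_iff[OF assms that] by (metis (no_types, lifting) UN_iff UNIV_I diff_add_cancel)
  then show ?thesis
    unfolding shift_stable_def using susp_pow_subset susp_pow_isomorphic
    by (auto simp: level_def) blast+
qed

text \<open>Suspension moves both bounds by one, so the condition \<open>m \<le> n\<close>
  persists.\<close>

lemma shift_stable_bounded_part: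
  assumes "A \<subseteq> Obj T" "B \<subseteq> Obj T"
  shows "shift_stable (bounded_part T A B)"
proof -
  have mem: "X \<in> bounded_part T A B \<longleftrightarrow> (\<exists>m n. m \<le> n \<and> X \<in> level T A m \<and> X \<in> level T B n)" for X
    by (auto simp: bounded_part_def interval_part_def)
  have "SuspO T X \<in> bounded_part T A B \<longleftrightarrow> X \<in> bounded_part T A B" if X: "X \<in> Obj T" for X
  proof
    assume "SuspO T X \<in> bounded_part T A B"
    then obtain m n where "m \<le> n" "X \<in> level T A (m + 1)" "X \<in> level T B (n + 1)"
      using level_susp_iff[OF assms(1) X] level_susp_iff[OF assms(2) X] mem by blast
    then show "X \<in> bounded_part T A B"
      using mem[of X] by (metis add_le_cancel_right)
  next
    assume "X \<in> bounded_part T A B"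
    then obtain m n where "m \<le> n" "X \<in> level T A (m - 1 + 1)" "X \<in> level T B (n - 1 + 1)"
      using mem by auto
    then show "SuspO T X \<in> bounded_part T A B"
      using level_susp_iff[OF assms(1) X] level_susp_iff[OF assms(2) X] mem
      by (metis diff_right_mono)
  qed
  then show ?thesis
    unfolding shift_stable_def using susp_pow_subset susp_pow_isomorphic mem
    by (auto simp: level_def) blast+
qed

lemma triangulated_subcategoryI:
  assumes "shift_stable L" "\<And>Z. is_zero_object T Z \<Longrightarrow> Z \<in> L"
    and "\<And>X Y P. X \<in> L \<Longrightarrow> Y \<in> L \<Longrightarrow> is_biproduct T X Y P \<Longrightarrow> P \<in> L"
    and "\<And>X Y Z u v w. exact_triangle T X Y Z u v w \<Longrightarrow> X \<in> L \<Longrightarrow> Y \<in> L \<Longrightarrow> Z \<in> L"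
  shows "triangulated_subcategory T L"
proof -
  have "full_additive_subcategory T L"
    unfolding full_additive_subcategory_def
    using assms(1,2,3) ex_zero_object ex_biproduct unfolding shift_stable_def by (metis subsetD)
  then show ?thesis
    unfolding triangulated_subcategory_def
    using assms(1,4) shift_stable_susp_pow[OF assms(1)] unfolding shift_stable_def by blast
qed

end

section \<open>Orthogonal classes on which a triangle functor is bijective\<close>

context triangle_functor_pair
begin

lemma ff_trivial:
  assumes X: "X \<in> Obj T" and Y: "Y \<in> Obj T" and "Hom T X Y = {Zero T X Y}"
    and "Hom T' (fobj F X) (fobj F Y) = {Zero T' (fobj F X) (fobj F Y)}"
  shows "ff X Y"
  unfolding hom_bij_def using assms group_hom.hom_one[OF F_group_hom[OF X Y]]
  by (simp add: bij_betw_def)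

lemma F_zero_object: "is_zero_object T Z \<Longrightarrow> is_zero_object T' (fobj F Z)"
  by (rule additive_functor_zero_object[OF T.additive_category_axioms T'.additive_category_axioms
      F_additive])

lemma zero_object_ff_left:
  assumes Z: "is_zero_object T Z" and X: "X \<in> Obj T"
  shows "ff Z X"
proof (rule ff_trivial)
  show "Z \<in> Obj T"
    using Z by (simp add: is_zero_object_def)
  then show "Hom T Z X = {Zero T Z X}"
    using T.zero_object_hom_from[OF Z] T.zero_hom X by blast
  show "Hom T' (fobj F Z) (fobj F X) = {Zero T' (fobj F Z) (fobj F X)}"
    using T'.zero_object_hom_from[OF F_zero_object[OF Z]] T'.zero_hom functor_obj[OF F_functor]
      \<open>Z \<in> Obj T\<close> X by blast
qed (rule X)

lemma zero_object_ff_right: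
  assumes Z: "is_zero_object T Z" and X: "X \<in> Obj T"
  shows "ff X Z"
proof (rule ff_trivial)
  show "Z \<in> Obj T"
    using Z by (simp add: is_zero_object_def)
  then show "Hom T X Z = {Zero T X Z}"
    using T.zero_object_hom_to[OF Z] T.zero_hom X by blast
  show "Hom T' (fobj F X) (fobj F Z) = {Zero T' (fobj F X) (fobj F Z)}"
    using T'.zero_object_hom_to[OF F_zero_object[OF Z]] T'.zero_hom functor_obj[OF F_functor]
      \<open>Z \<in> Obj T\<close> X by blast
qed (rule X)

text \<open>Up to isomorphism \<open>Y\<close> is the suspension of some \<open>Y'\<close> in
  \<open>W\<close>, which reduces the claim to the pair \<open>(X, Y')\<close> by
  \<open>ff_susp_iff\<close>.\<close>

lemma ff_susp_left:
  assumes W: "T.shift_stable W" and X: "X \<in> Obj T" and ff: "\<And>Y. Y \<in> W \<Longrightarrow> ff X Y" and Y: "Y \<in> W"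
  shows "ff (SuspO T X) Y"
proof -
  obtain Y' where Y': "Y' \<in> W" "isomorphic T (SuspO T Y') Y"
    using T.shift_stable_desuspension[OF W Y] .
  then show ?thesis
    using ff_iso_right ff_susp_iff[OF X] ff[OF Y'(1)] W unfolding T.shift_stable_def by blast
qed

lemma ff_susp_right:
  assumes W: "T.shift_stable W" and Y: "Y \<in> Obj T" and ff: "\<And>X. X \<in> W \<Longrightarrow> ff X Y" and X: "X \<in> W"
  shows "ff X (SuspO T Y)"
proof -
  obtain X' where X': "X' \<in> W" "isomorphic T (SuspO T X') X"
    using T.shift_stable_desuspension[OF W X] .
  then show ?thesis
    using ff_iso_left ff_susp_iff[OF _ Y] ff[OF X'(1)] W unfolding T.shift_stable_def by blast
qed

lemma shift_stable_ff_left: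
  assumes W: "T.shift_stable W"
  shows "T.shift_stable {X \<in> Obj T. \<forall>Y\<in>W. ff X Y}" (is "T.shift_stable ?L")
proof -
  have "ff X Y" if "X \<in> Obj T" "\<forall>Y\<in>W. ff (SuspO T X) Y" "Y \<in> W" for X Y
    using that ff_susp_iff W unfolding T.shift_stable_def by blast
  then have down: "A \<in> ?L" if "A \<in> Obj T" "SuspO T A \<in> ?L" for A
    using that by simp
  have up: "SuspO T A \<in> ?L" if "A \<in> ?L" for A
    using ff_susp_left[OF W] that T.susp_obj by auto
  have iso: "Z \<in> ?L" if "A \<in> ?L" "isomorphic T A Z" for A Z
    using that T.isomorphic_objs[OF that(2)] ff_iso_left[OF that(2)] by simp
  show ?thesis
    unfolding T.shift_stable_def
  proof (intro conjI ballI allI impI iffI)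
    show "?L \<subseteq> Obj T"
      by blast
  qed (use iso down up in blast)+
qed

lemma shift_stable_ff_right:
  assumes W: "T.shift_stable W"
  shows "T.shift_stable {Y \<in> Obj T. \<forall>X\<in>W. ff X Y}" (is "T.shift_stable ?L")
proof -
  have "ff X Y" if "Y \<in> Obj T" "\<forall>X\<in>W. ff X (SuspO T Y)" "X \<in> W" for X Y
    using that ff_susp_iff W unfolding T.shift_stable_def by blast
  then have down: "A \<in> ?L" if "A \<in> Obj T" "SuspO T A \<in> ?L" for A
    using that by simp
  have up: "SuspO T A \<in> ?L" if "A \<in> ?L" for A
    using ff_susp_right[OF W] that T.susp_obj by auto
  have iso: "Z \<in> ?L" if "A \<in> ?L" "isomorphic T A Z" for A Z
    using that T.isomorphic_objs[OF that(2)] ff_iso_right[OF that(2)] by simp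
  show ?thesis
    unfolding T.shift_stable_def
  proof (intro conjI ballI allI impI iffI)
    show "?L \<subseteq> Obj T"
      by blast
  qed (use iso down up in blast)+
qed

lemma triangulated_subcategory_ff_left:
  assumes W: "T.shift_stable W"
  shows "triangulated_subcategory T {X \<in> Obj T. \<forall>Y\<in>W. ff X Y}" (is "triangulated_subcategory T ?L")
proof (rule T.triangulated_subcategoryI[OF shift_stable_ff_left[OF W]])
  have WO: "W \<subseteq> Obj T"
    using W by (simp add: T.shift_stable_def)
  show "Z \<in> ?L" if "is_zero_object T Z" for Z
    using zero_object_ff_left[OF that] that WO by (auto simp: is_zero_object_def)
  show "P \<in> ?L" if "X \<in> ?L" "Y \<in> ?L" "is_biproduct T X Y P" for X Y P
    using that hom_bij_biproduct_left[OF T.additive_category_axioms T'.additive_category_axioms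
        F_additive that(3)] by (auto simp: is_biproduct_def)
  show "Z \<in> ?L" if t: "exact_triangle T X Y Z u v w" and "X \<in> ?L" "Y \<in> ?L" for X Y Z u v w
    using that ff_cone_left[OF t] ff_susp_left[OF W] WO T.hom_objs[OF exact_triangle_homs(2)[OF t]]
    by auto
qed

lemma triangulated_subcategory_ff_right:
  assumes W: "T.shift_stable W"
  shows "triangulated_subcategory T {Y \<in> Obj T. \<forall>X\<in>W. ff X Y}" (is "triangulated_subcategory T ?L")
proof (rule T.triangulated_subcategoryI[OF shift_stable_ff_right[OF W]])
  have WO: "W \<subseteq> Obj T"
    using W by (simp add: T.shift_stable_def)
  show "Z \<in> ?L" if "is_zero_object T Z" for Z
    using zero_object_ff_right[OF that] that WO by (auto simp: is_zero_object_def)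
  show "P \<in> ?L" if "X \<in> ?L" "Y \<in> ?L" "is_biproduct T X Y P" for X Y P
    using that hom_bij_biproduct_right[OF T.additive_category_axioms T'.additive_category_axioms
        F_additive that(3)] by (auto simp: is_biproduct_def)
  show "Z \<in> ?L" if t: "exact_triangle T X Y Z u v w" and "X \<in> ?L" "Y \<in> ?L" for X Y Z u v w
    using that ff_cone_right[OF t] ff_susp_right[OF W] WO T.hom_objs[OF exact_triangle_homs(2)[OF t]]
    by auto
qed

text \<open>The objects good against all of \<open>W\<close> form one of the subcategories
  intersected in \<open>Loc\<close>: it is triangulated, contains \<open>S\<close>, and is closed
  under coproducts because \<open>F\<close> preserves these.\<close>

lemma Loc_ff:
  assumes W: "T.shift_stable W" and bc: "bi_continuous small T T' F"
    and S: "S \<subseteq> Obj T" "\<And>X Y. X \<in> S \<Longrightarrow> Y \<in> W \<Longrightarrow> ff X Y"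
    and X: "X \<in> Loc small T S" and Y: "Y \<in> W"
  shows "ff X Y"
proof -
  let ?L = "{X \<in> Obj T. \<forall>Y\<in>W. ff X Y}"
  have "P \<in> ?L" if P: "small I" "\<forall>i\<in>I. A i \<in> ?L" "is_coproduct T I A P \<iota>" for I A P \<iota>
  proof -
    have F: "is_coproduct T' I (\<lambda>i. fobj F (A i)) (fobj F P) (\<lambda>i. farr F (\<iota> i))"
      using bc P unfolding bi_continuous_def by blast
    have "ff P Y" if "Y \<in> W" for Y
      by (rule hom_bij_coproduct[OF F_functor P(3) F _ _ T.category_axioms T'.category_axioms])
        (use P(2) W that in \<open>auto simp: T.shift_stable_def\<close>)
    then show ?thesis
      using P(3) by (simp add: is_coproduct_def)
  qed
  moreover have "S \<subseteq> ?L"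
    using S by blast
  ultimately have "X \<in> ?L"
    using X triangulated_subcategory_ff_left[OF W] unfolding Loc_def by blast
  then show ?thesis
    using Y by blast
qed

text \<open>The dual of \<open>Loc_ff\<close>, with products in the second variable.\<close>

lemma coLoc_ff:
  assumes W: "T.shift_stable W" and bc: "bi_continuous small T T' F"
    and S: "S \<subseteq> Obj T" "\<And>X Y. X \<in> W \<Longrightarrow> Y \<in> S \<Longrightarrow> ff X Y"
    and Y: "Y \<in> coLoc small T S" and X: "X \<in> W"
  shows "ff X Y"
proof -
  let ?L = "{Y \<in> Obj T. \<forall>X\<in>W. ff X Y}"
  have "P \<in> ?L" if P: "small I" "\<forall>i\<in>I. A i \<in> ?L" "is_product T I A P \<pi>" for I A P \<pi>
  proof -
    have F: "is_product T' I (\<lambda>i. fobj F (A i)) (fobj F P) (\<lambda>i. farr F (\<pi> i))"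
      using bc P unfolding bi_continuous_def by blast
    have "ff X P" if "X \<in> W" for X
      by (rule hom_bij_product[OF F_functor P(3) F _ _ T.category_axioms T'.category_axioms])
        (use P(2) W that in \<open>auto simp: T.shift_stable_def\<close>)
    then show ?thesis
      using P(3) by (simp add: is_product_def)
  qed
  moreover have "S \<subseteq> ?L"
    using S by blast
  ultimately have "Y \<in> ?L"
    using Y triangulated_subcategory_ff_right[OF W] unfolding coLoc_def by blast
  then show ?thesis
    using X by blast
qed

text \<open>Both objects are shifted by the same power of \<Sigma>, which keeps goodness while
  levels move by \<open>k\<close>. One existence statement collects all the invariants, since a
  negative power of \<Sigma> is determined only up to isomorphism.\<close>

lemma ex_simultaneous_shift:
  assumes "X \<in> Obj T" "Y \<in> Obj T"
  shows "\<exists>X'\<in>Obj T. \<exists>Y'\<in>Obj T. (ff X' Y' \<longleftrightarrow> ff X Y) \<and>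
    (\<forall>A m. A \<subseteq> Obj T \<longrightarrow> (X' \<in> level T A (m + k) \<longleftrightarrow> X \<in> level T A m)) \<and>
    (\<forall>A m. A \<subseteq> Obj T \<longrightarrow> (Y' \<in> level T A (m + k) \<longleftrightarrow> Y \<in> level T A m)) \<and>
    (\<forall>W. T.shift_stable W \<longrightarrow> (X' \<in> W \<longleftrightarrow> X \<in> W))"
    (is "\<exists>X'\<in>Obj T. \<exists>Y'\<in>Obj T. ?P k X' Y'")
proof (induction k rule: int_induct[where k = 0])
  case base
  then show ?case
    using assms by auto
next
  case (step1 k)
  then obtain X' Y' where XY: "X' \<in> Obj T" "Y' \<in> Obj T" "?P k X' Y'"
    by blast
  \<comment> \<open>Levels rise under desuspension, as \<open>level T A m\<close> is the power
    \<open>- m\<close> of \<Sigma>; hence this direction desuspends and the other one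
    suspends.\<close>
  obtain X'' where X'': "X'' \<in> Obj T" "isomorphic T (SuspO T X'') X'"
    using T.ex_desuspension[OF XY(1)] by blast
  obtain Y'' where Y'': "Y'' \<in> Obj T" "isomorphic T (SuspO T Y'') Y'"
    using T.ex_desuspension[OF XY(2)] by blast
  have lev: "Z \<in> level T A (m + (k + 1)) \<longleftrightarrow> Z' \<in> level T A (m + k)"
    if "A \<subseteq> Obj T" "Z \<in> Obj T" "isomorphic T (SuspO T Z) Z'" for A m Z Z'
    using T.level_susp_iff[OF that(1,2), of "m + k"] that(3) T.isomorphic_sym
      T.susp_pow_isomorphic unfolding level_def by (metis add.assoc)
  have "ff X'' Y'' \<longleftrightarrow> ff X' Y'"
    using ff_susp_iff[OF X''(1) Y''(1)] ff_iso_left ff_iso_right T.isomorphic_sym X''(2) Y''(2)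
    by blast
  moreover have "X'' \<in> W \<longleftrightarrow> X' \<in> W" if "T.shift_stable W" for W
    using that X'' T.isomorphic_sym unfolding T.shift_stable_def by blast
  ultimately have "?P (k + 1) X'' Y''"
    using lev[OF _ X''] lev[OF _ Y''] XY(3) by simp
  then show ?case
    using X'' Y'' by blast
next
  case (step2 k)
  then obtain X' Y' where XY: "X' \<in> Obj T" "Y' \<in> Obj T" "?P k X' Y'"
    by blast
  have lev: "SuspO T Z \<in> level T A (m + (k - 1)) \<longleftrightarrow> Z \<in> level T A (m + k)"
    if "A \<subseteq> Obj T" "Z \<in> Obj T" for A m Z
    using T.level_susp_iff[OF that, of "m + (k - 1)"] by (simp add: algebra_simps)
  have "SuspO T X' \<in> W \<longleftrightarrow> X' \<in> W" if "T.shift_stable W" for W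
    using that XY(1) unfolding T.shift_stable_def by blast
  then have P: "?P (k - 1) (SuspO T X') (SuspO T Y')"
    using lev[OF _ XY(1)] lev[OF _ XY(2)] XY(3) ff_susp_iff[OF XY(1,2)] by simp
  show ?case
    by (rule bexI[where x = "SuspO T X'"], rule bexI[where x = "SuspO T Y'"], rule P)
      (simp_all add: T.susp_obj XY(1,2))
qed

end

section \<open>Pre-weight structures\<close>

locale bounded_triangle_functor = triangle_functor_pair T T' F \<omega>
  for T :: "('o, 'm, 'a) tri_cat_scheme" and T' :: "('p, 'n, 'b) tri_cat_scheme"
    and F :: "('o, 'm, 'p, 'n) functor_data" and \<omega> :: "'o \<Rightarrow> 'n" +
  fixes U V :: "'o set"
  assumes pws: "pre_weight_structure T U V" and finite_dim: "pws_dimension T U V \<noteq> \<infinity>"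
    and bounded: "bounded_functor T T' F U V"
begin

lemma U_obj: "U \<subseteq> Obj T" and V_obj: "V \<subseteq> Obj T"
  using pws by (auto simp: pre_weight_structure_def full_additive_subcategory_def)

lemma susp_V: "susp_pow T 1 V \<subseteq> V"
  using pws by (simp add: pre_weight_structure_def)

text \<open>Rotating back the triangle of axiom (i) exhibits every object as the cone of a morphism,
  so that the closure under cones of the classes above applies to it.\<close>

lemma weight_decomposition:
  assumes "X \<in> Obj T"
  obtains A B B' s u v where "A \<in> U" "B \<in> susp_pow T 1 V" "B' \<in> Obj T" "isomorphic T (SuspO T B') B"
    "exact_triangle T B' A X s u v"
proof -
  obtain A B u v w where AB: "A \<in> U" "B \<in> susp_pow T 1 V" "exact_triangle T A X B u v w"
    using assms pws unfolding pre_weight_structure_def star_def by blast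
  obtain B' where B': "B' \<in> Obj T" "isomorphic T (SuspO T B') B"
    using T.ex_desuspension AB(2) T.susp_pow_subset by blast
  then show thesis
    using T.exact_triangle_rotate_back[OF AB(3) B'] that AB by blast
qed

text \<open>Finite dimension makes the Hom groups in \<open>T\<close> vanish far below, boundedness
  of \<open>F\<close> those in \<open>T'\<close>, and a map between zero groups is bijective. A
  single \<open>N\<close> serves all \<open>m\<close> because a simultaneous shift reduces to
  \<open>m = 0\<close>.\<close>

lemma ff_vanishing: "\<exists>N. \<forall>m n X Y. n \<le> m - N \<and> X \<in> level T U m \<and> Y \<in> level T V n \<longrightarrow> ff X Y"
proof -
  \<comment> \<open>The infimum of the empty set is \<infinity>, so finite dimension provides some
    \<open>d\<close>.\<close>
  have "{ereal (real_of_int d) | d. d \<ge> -1 \<and> Hom_zero T U (level T V (- (d + 1)))} \<noteq> {}"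
    using finite_dim unfolding pws_dimension_def by (metis Inf_empty top_ereal_def)
  then obtain d where d: "Hom_zero T U (level T V (- (d + 1)))"
    by blast
  obtain n0 where n0: "Hom_zero T' (fobj F ` U) (fobj F ` level T V (- int n0))"
    using bounded unfolding bounded_functor_def by blast
  \<comment> \<open>\<open>N\<close> passes both thresholds; the levels of \<open>V\<close> are
    nested, so a level at most \<open>- N\<close> lies inside each of the two where Hom is known to
    vanish.\<close>
  define N where "N = max (d + 1) (int n0)"
  have base: "ff X Y" if X: "X \<in> U" and Y: "Y \<in> level T V n" and n: "n \<le> - N" for X Y n
  proof -
    have "d + 1 \<le> - n" "int n0 \<le> - n"
      using n by (simp_all add: N_def)
    then have "Y \<in> level T V (- (d + 1))" "Y \<in> level T V (- int n0)"
      using Y n T.susp_pow_antimono[OF V_obj susp_V, of "d + 1" "- n"]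
        T.susp_pow_antimono[OF V_obj susp_V, of "int n0" "- n"] unfolding level_def minus_minus by blast+
    then show ?thesis
      using ff_trivial[of X Y] d n0 X U_obj T.susp_pow_subset unfolding Hom_zero_def level_def by blast
  qed
  have "ff X Y" if n: "n \<le> m - N" and X: "X \<in> level T U m" and Y: "Y \<in> level T V n" for m n X Y
  proof -
    have O: "X \<in> Obj T" "Y \<in> Obj T"
      using X Y T.susp_pow_subset by (auto simp: level_def)
    obtain X' Y' where XY: "ff X' Y' \<longleftrightarrow> ff X Y" "X' \<in> level T U (m - m)" "Y' \<in> level T V (n - m)"
      using ex_simultaneous_shift[OF O, of "- m"] U_obj V_obj X Y
      by (metis (no_types, lifting) uminus_add_conv_diff add.commute)
    \<comment> \<open>Level 0 consists by definition of the objects isomorphic to one of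
      \<open>U\<close>.\<close>
    obtain Z where "Z \<in> U" "isomorphic T Z X'"
      using XY(2) by (auto simp: level_def susp_pow_def)
    then show ?thesis
      using base[OF _ XY(3)] n XY(1) ff_iso_left by auto
  qed
  then show ?thesis
    by blast
qed

text \<open>A shift puts \<open>X\<close> in \<open>level T U N\<close>, far enough for the Hom
  groups into the \<open>V\<close>-part of the decomposed second object to vanish in
  \<open>T\<close> and after \<open>F\<close>. Goodness against the \<open>U\<close>-part is the
  hypothesis \<open>WU\<close>, and the cone lemma combines the two.\<close>

lemma ff_from_weight_bounded_below:
  assumes W: "T.shift_stable W" "\<And>X. X \<in> W \<Longrightarrow> \<exists>m. X \<in> level T U m"
    and WU: "\<And>X A. X \<in> W \<Longrightarrow> A \<in> U \<Longrightarrow> ff X A" and X: "X \<in> W" and Y: "Y \<in> Obj T"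
  shows "ff X Y"
proof -
  obtain N where N: "\<And>m n X Y. n \<le> m - N \<Longrightarrow> X \<in> level T U m \<Longrightarrow> Y \<in> level T V n \<Longrightarrow> ff X Y"
    using ff_vanishing by blast
  have XO: "X \<in> Obj T"
    using X W by (auto simp: T.shift_stable_def)
  obtain m where m: "X \<in> level T U m"
    using W(2)[OF X] by blast
  obtain X' Y' where XY: "X' \<in> Obj T" "Y' \<in> Obj T" "ff X' Y' \<longleftrightarrow> ff X Y" "X' \<in> level T U (m + (N - m))"
      "X' \<in> W"
    using ex_simultaneous_shift[OF XO Y, of "N - m"] U_obj m X W(1) by metis
  have X'N: "X' \<in> level T U N"
    using XY(4) by simp
  obtain A B B' s u v where A: "A \<in> U" and B: "B \<in> susp_pow T 1 V" and B': "B' \<in> Obj T"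
      "isomorphic T (SuspO T B') B" and t: "exact_triangle T B' A Y' s u v"
    using weight_decomposition[OF XY(2)] .
  have SB': "SuspO T B' \<in> level T V (-1)"
    using B B'(2) T.isomorphic_sym T.susp_pow_isomorphic by (fastforce simp: level_def)
  \<comment> \<open>\<open>B\<close> lies in the suspension of \<open>V\<close>, so its desuspension
    sits at level 0, exactly \<open>N\<close> below the level of \<open>X'\<close>.\<close>
  then have "B' \<in> level T V 0"
    using T.level_susp_iff[OF V_obj B'(1), of "-1"] by simp
  then have "ff X' B'" "ff X' (SuspO T B')"
    using N[OF _ X'N, of 0 B'] N[OF _ X'N SB'] by simp_all
  \<comment> \<open>\<open>SuspO T A\<close> may lie outside \<open>U\<close>; stability of
    \<open>W\<close> is used instead.\<close>
  moreover have "ff X' (SuspO T A)"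
    using ff_susp_right[OF W(1) _ WU[OF _ A] XY(5)] A U_obj by blast
  ultimately have "ff X' Y'"
    using ff_cone_right[OF t XY(1)] WU[OF XY(5) A] by blast
  then show ?thesis
    using XY(3) by blast
qed

text \<open>The first object is decomposed this time. Shifting \<open>Y\<close> far down makes the
  \<open>U\<close>-part orthogonal to it, in \<open>T\<close> and after \<open>F\<close>, while the
  \<open>V\<close>-part is good against everything by hypothesis.\<close>

lemma ff_to_weight_bounded_above:
  assumes VY: "\<And>B Y. B \<in> V \<Longrightarrow> Y \<in> Obj T \<Longrightarrow> ff B Y" and X: "X \<in> Obj T" and Y: "Y \<in> level T V n"
  shows "ff X Y"
proof -
  obtain N where N: "\<And>m n X Y. n \<le> m - N \<Longrightarrow> X \<in> level T U m \<Longrightarrow> Y \<in> level T V n \<Longrightarrow> ff X Y"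
    using ff_vanishing by blast
  have YO: "Y \<in> Obj T"
    using Y T.susp_pow_subset by (auto simp: level_def)
  \<comment> \<open>The extra \<open>- 1\<close> leaves room for \<open>SuspO T A\<close>, which
    sits at level -1 and enters through the cone lemma.\<close>
  obtain X' Y' where XY: "X' \<in> Obj T" "Y' \<in> Obj T" "ff X' Y' \<longleftrightarrow> ff X Y"
      "Y' \<in> level T V (n + (- N - 1 - n))"
    using ex_simultaneous_shift[OF X YO, of "- N - 1 - n"] V_obj Y by metis
  have Y'N: "Y' \<in> level T V (- N - 1)"
    using XY(4) by simp
  obtain A B B' s u v where A: "A \<in> U" and B: "B \<in> susp_pow T 1 V" and B': "B' \<in> Obj T"
      "isomorphic T (SuspO T B') B" and t: "exact_triangle T B' A X' s u v"
    using weight_decomposition[OF XY(1)] .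
  have SB': "ff (SuspO T B') Y" if "Y \<in> Obj T" for Y
    using VY[OF _ that] B susp_V ff_iso_left[OF T.isomorphic_sym[OF B'(2)]] by blast
  \<comment> \<open>The previous fact is taken at \<open>SuspO T Y'\<close>, and both objects are
    then desuspended.\<close>
  then have "ff B' Y'"
    using ff_susp_iff[OF B'(1) XY(2)] T.susp_obj[OF XY(2)] by blast
  moreover have A0: "A \<in> level T U 0"
    using A T.subset_susp_pow_0[OF U_obj] by (auto simp: level_def)
  moreover have "SuspO T A \<in> level T U (-1)"
    using T.level_susp_iff[OF U_obj, of A "-1"] A U_obj A0 by auto
  ultimately have "ff A Y'" "ff (SuspO T A) Y'" "ff B' Y'"
    using N[OF _ _ Y'N, of 0 A] N[OF _ _ Y'N, of "-1" "SuspO T A"] by simp_all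
  then have "ff X' Y'"
    using ff_cone_left[OF t XY(2)] SB'[OF XY(2)] by blast
  then show ?thesis
    using XY(3) by blast
qed

lemma ff_from_weight_pieces:
  assumes "\<And>A Y. A \<in> U \<Longrightarrow> Y \<in> Obj T \<Longrightarrow> ff A Y" "\<And>B Y. B \<in> V \<Longrightarrow> Y \<in> Obj T \<Longrightarrow> ff B Y"
    and X: "X \<in> Obj T" and Y: "Y \<in> Obj T"
  shows "ff X Y"
proof -
  define L where "L = {X \<in> Obj T. \<forall>Y\<in>Obj T. ff X Y}"
  have L: "triangulated_subcategory T L" "T.shift_stable L"
    unfolding L_def
    by (rule triangulated_subcategory_ff_left shift_stable_ff_left, rule T.shift_stable_Obj)+
  obtain A B B' s u v where AB: "A \<in> U" "B \<in> susp_pow T 1 V" "B' \<in> Obj T" "isomorphic T (SuspO T B') B"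
    and t: "exact_triangle T B' A X s u v"
    using weight_decomposition[OF X] .
  have "A \<in> L" "B \<in> L"
    unfolding L_def using AB susp_V U_obj V_obj assms(1,2) by blast+
  \<comment> \<open>\<open>B'\<close> is given through its suspension; stability of \<open>L\<close>
    passes membership down to it.\<close>
  moreover have "B' \<in> L"
    using \<open>B \<in> L\<close> L(2) AB(3,4) T.isomorphic_sym unfolding T.shift_stable_def by blast
  ultimately have "X \<in> L"
    using L(1) t unfolding triangulated_subcategory_def by blast
  then show ?thesis
    using Y by (simp add: L_def)
qed

end

theorem theorem5p7:
  fixes T :: "('o, 'm, 'a) tri_cat_scheme"
    and T' :: "('p, 'n, 'b) tri_cat_scheme"
    and F :: "('o, 'm, 'p, 'n) functor_data"
    and \<omega> :: "'o \<Rightarrow> 'n"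
    and U V :: "'o set"
    and small :: "'i set \<Rightarrow> bool"
  assumes "triangulated_category T" and "triangulated_category T'"
    and "bi_complete small T" and "bi_complete small T'"
    and "triangle_functor T T' F \<omega>"
    and "bi_continuous small T T' F"
    and "pre_weight_structure T U V" and "pws_dimension T U V \<noteq> \<infinity>"
    and "V \<subseteq> Loc small T (bounded_part T U V)"
    and "U \<subseteq> coLoc small T (bounded_part T U V)"
    and "bounded_functor T T' F U V"
    and "fully_faithful_on T T' F (bounded_part T U V)"
  shows "fully_faithful T T' F"
proof -
  interpret bounded_triangle_functor T T' F \<omega> U V
    by (intro bounded_triangle_functor.intro triangle_functor_pair.intro
        triangle_functor_pair_axioms.intro bounded_triangle_functor_axioms.intro) fact+
  let ?b = "bounded_part T U V"
  have b: "T.shift_stable ?b"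
    by (rule T.shift_stable_bounded_part[OF U_obj V_obj])
  then have b_obj: "?b \<subseteq> Obj T"
    by (simp add: T.shift_stable_def)
  have ff_b: "\<And>X Y. X \<in> ?b \<Longrightarrow> Y \<in> ?b \<Longrightarrow> ff X Y"
    using assms(12) by (simp add: fully_faithful_on_iff)
  have b_level: "\<exists>m n. X \<in> level T U m \<and> X \<in> level T V n" if "X \<in> ?b" for X
    using that by (auto simp: bounded_part_def interval_part_def)
  \<comment> \<open>Products extend goodness inside the bounded part to \<open>U\<close> in the
    second variable.\<close>
  have "ff X A" if "X \<in> ?b" "A \<in> U" for X A
    by (rule coLoc_ff[OF b assms(6) b_obj ff_b _ that(1)]) (use assms(10) that in auto)
  \<comment> \<open>Objects of the bounded part are bounded below, so decomposing the second
    variable removes its restriction.\<close>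
  then have b_all: "ff X Y" if "X \<in> ?b" "Y \<in> Obj T" for X Y
    using ff_from_weight_bounded_below[OF b _ _ that] b_level by blast
  \<comment> \<open>With every second object allowed, the test class is all of \<open>Obj T\<close>,
    and coproducts extend the first variable to \<open>V\<close>.\<close>
  have V_all: "ff B Y" if "B \<in> V" "Y \<in> Obj T" for B Y
    by (rule Loc_ff[OF T.shift_stable_Obj assms(6) b_obj b_all _ that(2)]) (use assms(9) that in auto)
  \<comment> \<open>The bounded part is now used from its other end: its objects are bounded above,
    so the first variable can be decomposed.\<close>
  then have all_b: "ff X Y" if "X \<in> Obj T" "Y \<in> ?b" for X Y
    using ff_to_weight_bounded_above[OF V_all that(1)] b_level[OF that(2)] by blast
  have all_U: "ff X A" if "X \<in> Obj T" "A \<in> U" for X A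
    by (rule coLoc_ff[OF T.shift_stable_Obj assms(6) b_obj all_b _ that(1)]) (use assms(10) that in auto)
  \<comment> \<open>The second decomposition of the second variable needs a shift-stable class of
    objects bounded below, so \<open>U\<close> is enlarged to the union of its levels.\<close>
  let ?W = "\<Union>m. level T U m"
  have W: "T.shift_stable ?W"
    by (rule T.shift_stable_levels[OF U_obj])
  have "U \<subseteq> ?W"
    using T.subset_susp_pow_0[OF U_obj] by (force simp: level_def intro: exI[of _ 0])
  have "ff A Y" if "A \<in> U" "Y \<in> Obj T" for A Y
    by (rule ff_from_weight_bounded_below[OF W _ all_U _ that(2)])
      (use that(1) W \<open>U \<subseteq> ?W\<close> in \<open>auto simp: T.shift_stable_def\<close>)
  then show ?thesis
    using ff_from_weight_pieces[OF _ V_all] by (simp add: fully_faithful_def fully_faithful_on_iff)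
qed

end
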